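(* Let $Y\cong(\mathbb C^n,0)$, let $X\subseteq Y$ be a reduced Cohen--Macaulay germ of codimension $k\ge2$, let $C\subseteq Y$ be a reduced complete intersection of codimension $k$ with $X\subseteq C$, and let $\alpha_X\in\Omega_Y^k$ be a fundamental form of $X$ in $Y$. Then $$\operatorname{Der}^q(-\log C)\subseteq\{\delta\in\Theta_Y^q\mid\langle\delta,\alpha_X\wedge\Omega_Y^{q-k}\rangle\subseteq\mathcal I_X\}=\operatorname{Der}^q(-\log X)=\{\delta\in\Theta_Y^q\mid\langle\delta,\alpha_X\wedge\Omega_Y^{q-k}\rangle\subseteq\mathcal I_C\}.$$
   Context: $Y$ is a germ of a smooth complex analytic space of dimension $n$, $\mathcal O_Y\cong\mathbb C\{x_1,\dots,x_n\}$. $\Omega_Y^q$ is the free $\mathcal O_Y$-module of holomorphic differential $q$-forms and $\Theta_Y^q=\bigwedge^q\operatorname{Der}_{\mathbb C}(\mathcal O_Y)=\operatorname{Hom}_{\mathcal O_Y}(\Omega_Y^q,\mathcal O_Y)$, with the perfect pairing $\langle-,-\rangle\colon\Theta_Y^q\times\Omega_Y^q\to\mathcal O_Y$ for which the standard coordinate bases are dual. $\mathcal I_C\subseteq\mathcal I_X$ are the ideals of $C$ and $X$ in $\mathcal O_Y$; $\underline h=(h_1,\dots,h_k)$ is a regular sequence generating $\mathcal I_C$ and $d\underline h=dh_1\wedge\dots\wedge dh_k$. Multi-logarithmic $q$-vector fields along $Z\in\{C,X\}$: $$\operatorname{Der}^q(-\log Z)=\{\delta\in\Theta_Y^q\mid\langle\delta,\textstyle\bigwedge^kd\mathcal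 I_Z\wedge\Omega_Y^{q-k}\rangle\subseteq\mathcal I_Z\},$$ where $\bigwedge^kd\mathcal I_Z\wedge\Omega_Y^{q-k}$ consists of (sums of) forms $df_1\wedge\dots\wedge df_k\wedge\xi$ with $f_i\in\mathcal I_Z$, $\xi\in\Omega_Y^{q-k}$. For $Z=C$ this equals $\{\delta\mid\langle\delta,d\underline h\wedge\Omega_Y^{q-k}\rangle\subseteq\mathcal I_C\}$. Let $X'=\overline{C\setminus X}$. The total rings of fractions satisfy $\mathcal Q_C=\mathcal Q_X\times\mathcal Q_{X'}$; let $\mathbf 1_X=(1,0)\in\mathcal Q_C$. A fundamental form of $X$ in $Y$ is an $\alpha_X\in\Omega_Y^k$ whose image in $\mathcal Q_C\otimes_{\mathcal O_Y}\Omega_Y^k$ equals that of $\mathbf 1_X\,d\underline h$. *)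

theory Defs
  imports
    "HOL-Analysis.Analysis"
    "HOL-Algebra.QuotRing"
    "HOL-Algebra.Ring_Divisibility"
    "HOL-Algebra.Algebraic_Closure_Type"
    "HOL-Library.Extended_Nat"
begin

section \<open>Convergent power series\<close>

text \<open>
  The ring of convergent power series in the variables \<open>x\<^sub>i\<close>, \<open>i :: 'n\<close>, that is
  the ring of holomorphic function germs at the origin of \<open>complex ^ 'n\<close>. Multi-indices are
  functions \<open>'n \<Rightarrow> nat\<close>, ordered pointwise. A family of coefficients is convergent if it
  converges absolutely on some polydisc with polyradius \<open>(r, \<dots>, r)\<close>.
\<close>

definition conv_coeffs :: "(('n::finite \<Rightarrow> nat) \<Rightarrow> complex) \<Rightarrow> bool" where
  "conv_coeffs c \<longleftrightarrow> (\<exists>r>0. (\<lambda>a. norm (c a) * r ^ (\<Sum>i\<in>UNIV. a i)) summable_on UNIV)"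

lemma conv_coeffs_smaller_radius:
  fixes c :: "('n::finite \<Rightarrow> nat) \<Rightarrow> complex"
  assumes "(\<lambda>a. norm (c a) * r ^ (\<Sum>i\<in>UNIV. a i)) summable_on UNIV" "0 \<le> s" "s \<le> (r::real)"
  shows "(\<lambda>a. norm (c a) * s ^ (\<Sum>i\<in>UNIV. a i)) summable_on UNIV"
  by (rule summable_on_comparison_test[OF assms(1)])
     (use assms in \<open>auto intro!: mult_left_mono power_mono\<close>)

lemma conv_coeffs_common_radius:
  fixes c d :: "('n::finite \<Rightarrow> nat) \<Rightarrow> complex"
  assumes "conv_coeffs c" "conv_coeffs d"
  obtains r :: real where "r > 0"
    "(\<lambda>a. norm (c a) * r ^ (\<Sum>i\<in>UNIV. a i)) summable_on UNIV"
    "(\<lambda>a. norm (d a) * r ^ (\<Sum>i\<in>UNIV. a i)) summable_on UNIV"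
proof -
  from assms obtain r s :: real where
    "r > 0" "(\<lambda>a. norm (c a) * r ^ (\<Sum>i\<in>UNIV. a i)) summable_on UNIV"
    "s > 0" "(\<lambda>a. norm (d a) * s ^ (\<Sum>i\<in>UNIV. a i)) summable_on UNIV"
    unfolding conv_coeffs_def by blast
  then show ?thesis
    by (intro that[of "min r s"]) (auto intro: conv_coeffs_smaller_radius)
qed

lemma finite_atMost_multi_index [simp]: "finite {..a :: 'n::finite \<Rightarrow> nat}"
proof (rule finite_subset)
  have "b i \<le> Max (range a)" if "b \<le> a" for b i
    using that by (meson Max_ge finite finite_imageI le_funD order_trans rangeI)
  then show "{..a} \<subseteq> {f. \<forall>x. (x \<in> UNIV \<longrightarrow> f x \<in> {..Max (range a)}) \<and> (x \<notin> UNIV \<longrightarrow> f x = 0)}"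
    by auto
qed (rule finite_set_of_finite_funs; simp)

definition cauchy_prod ::
  "(('n::finite \<Rightarrow> nat) \<Rightarrow> complex) \<Rightarrow> (('n \<Rightarrow> nat) \<Rightarrow> complex) \<Rightarrow> ('n \<Rightarrow> nat) \<Rightarrow> complex" where
  "cauchy_prod c d a = (\<Sum>b\<in>{..a}. c b * d (\<lambda>i. a i - b i))"

lemma conv_coeffs_cauchy_prod:
  fixes c d :: "('n::finite \<Rightarrow> nat) \<Rightarrow> complex"
  assumes "conv_coeffs c" "conv_coeffs d"
  shows "conv_coeffs (cauchy_prod c d)"
proof -
  obtain r :: real where r: "r > 0"
    "(\<lambda>a. norm (c a) * r ^ (\<Sum>i\<in>UNIV. a i)) summable_on UNIV"
    "(\<lambda>a. norm (d a) * r ^ (\<Sum>i\<in>UNIV. a i)) summable_on UNIV"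
    by (rule conv_coeffs_common_radius[OF assms])
  define p where "p a = norm (c a) * r ^ (\<Sum>i\<in>UNIV. a i)" for a
  define q where "q a = norm (d a) * r ^ (\<Sum>i\<in>UNIV. a i)" for a
  have pq: "p summable_on UNIV" "q summable_on UNIV" "\<And>a. p a \<ge> 0" "\<And>a. q a \<ge> 0"
    using r by (auto simp: p_def[abs_def] q_def[abs_def])
  have "(\<lambda>(b, e). p b * q e) summable_on (UNIV \<times> UNIV)"
  proof (rule summable_on_SigmaI)
    show "((\<lambda>e. (case (b, e) of (b, e) \<Rightarrow> p b * q e)) has_sum (p b * infsum q UNIV)) UNIV" for b
      using pq by (auto intro: has_sum_cmult_right)
    show "(\<lambda>b. p b * infsum q UNIV) summable_on UNIV"
      using pq by (auto intro: summable_on_cmult_left)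
  qed (use pq in auto)
  also have "?this \<longleftrightarrow> (\<lambda>(a, b). p b * q (\<lambda>i. a i - b i)) summable_on (SIGMA a:UNIV. {..a})"
    by (rule summable_on_reindex_bij_witness[where
          i = "\<lambda>(a, b). (b, \<lambda>i. a i - b i)" and j = "\<lambda>(b, e). (\<lambda>i. b i + e i, b)"])
       (auto simp: le_fun_def)
  finally have "(\<lambda>a. infsum (\<lambda>b. case (a, b) of (a, b) \<Rightarrow> p b * q (\<lambda>i. a i - b i)) {..a}) summable_on UNIV"
    by (rule summable_on_SigmaD) auto
  then have sm: "(\<lambda>a. \<Sum>b\<in>{..a}. p b * q (\<lambda>i. a i - b i)) summable_on UNIV"
    by simp
  have "(\<lambda>a. norm (cauchy_prod c d a) * r ^ (\<Sum>i\<in>UNIV. a i)) summable_on UNIV"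
  proof (rule summable_on_comparison_test[OF sm])
    fix a :: "'n \<Rightarrow> nat"
    have pw: "r ^ (\<Sum>i\<in>UNIV. b i) * r ^ (\<Sum>i\<in>UNIV. a i - b i) = r ^ (\<Sum>i\<in>UNIV. a i)" if "b \<le> a" for b
      using that by (simp flip: power_add sum.distrib add: le_fun_def)
    have "norm (cauchy_prod c d a) * r ^ (\<Sum>i\<in>UNIV. a i)
        \<le> (\<Sum>b\<in>{..a}. norm (c b * d (\<lambda>i. a i - b i))) * r ^ (\<Sum>i\<in>UNIV. a i)"
      unfolding cauchy_prod_def using r(1) by (intro mult_right_mono norm_sum) auto
    also have "\<dots> = (\<Sum>b\<in>{..a}. p b * q (\<lambda>i. a i - b i))"
      unfolding sum_distrib_right
      by (rule sum.cong) (auto simp: p_def q_def norm_mult simp flip: pw)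
    finally show "norm (cauchy_prod c d a) * r ^ (\<Sum>i\<in>UNIV. a i)
        \<le> (\<Sum>b\<in>{..a}. p b * q (\<lambda>i. a i - b i))" .
  qed (use r in auto)
  with r(1) show ?thesis
    unfolding conv_coeffs_def by blast
qed

lemma cauchy_prod_commute:
  "cauchy_prod c d = cauchy_prod d (c :: ('n::finite \<Rightarrow> nat) \<Rightarrow> complex)"
proof
  fix a
  show "cauchy_prod c d a = cauchy_prod d c a"
    unfolding cauchy_prod_def
    by (rule sum.reindex_bij_witness[where i = "\<lambda>b i. a i - b i" and j = "\<lambda>b i. a i - b i"])
       (auto simp: le_fun_def mult.commute)
qed

lemma cauchy_prod_assoc:
  "cauchy_prod (cauchy_prod x y) z = cauchy_prod x (cauchy_prod y (z :: ('n::finite \<Rightarrow> nat) \<Rightarrow> complex))"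
proof
  fix a
  have "cauchy_prod (cauchy_prod x y) z a =
      (\<Sum>(b, e)\<in>(SIGMA b:{..a}. {..b}). x e * y (\<lambda>i. b i - e i) * z (\<lambda>i. a i - b i))"
    unfolding cauchy_prod_def sum_distrib_right by (simp add: sum.Sigma)
  also have "\<dots> = (\<Sum>(e, f)\<in>(SIGMA e:{..a}. {..\<lambda>i. a i - e i}).
      x e * (y f * z (\<lambda>i. a i - e i - f i)))"
  proof (rule sum.reindex_bij_witness[where
        i = "\<lambda>(e, f). (\<lambda>i. e i + f i, e)" and j = "\<lambda>(b, e). (e, \<lambda>i. b i - e i)"])
    fix p assume p: "p \<in> (SIGMA b:{..a}. {..b})"
    obtain b e where [simp]: "p = (b, e)" by (cases p)
    have le: "e i \<le> b i" "b i \<le> a i" for i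
      using p by (auto simp: le_fun_def)
    have "e \<le> a"
      using p by auto
    moreover have "(\<lambda>i. b i - e i) \<le> (\<lambda>i. a i - e i)"
      using le by (simp add: le_fun_def diff_le_mono)
    ultimately show "(case p of (b, e) \<Rightarrow> (e, \<lambda>i. b i - e i)) \<in> (SIGMA e:{..a}. {..\<lambda>i. a i - e i})"
      by simp
    show "(case case p of (b, e) \<Rightarrow> (e, \<lambda>i. b i - e i) of (e, f) \<Rightarrow> (\<lambda>i. e i + f i, e)) = p"
      using le by simp
    have "a i - e i - (b i - e i) = a i - b i" for i
      using le[of i] by simp
    then show "(case case p of (b, e) \<Rightarrow> (e, \<lambda>i. b i - e i) of
        (e, f) \<Rightarrow> x e * (y f * z (\<lambda>i. a i - e i - f i))) =
        (case p of (b, e) \<Rightarrow> x e * y (\<lambda>i. b i - e i) * z (\<lambda>i. a i - b i))"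
      by (simp add: mult.assoc)
  next
    fix p assume p: "p \<in> (SIGMA e:{..a}. {..\<lambda>i. a i - e i})"
    obtain e f where [simp]: "p = (e, f)" by (cases p)
    have le: "e i \<le> a i" "f i \<le> a i - e i" for i
      using p by (auto simp: le_fun_def)
    then have "e i + f i \<le> a i" for i
      by (simp add: le_diff_conv2 add.commute)
    then show "(case p of (e, f) \<Rightarrow> (\<lambda>i. e i + f i, e)) \<in> (SIGMA b:{..a}. {..b})"
      by (simp add: le_fun_def)
    show "(case case p of (e, f) \<Rightarrow> (\<lambda>i. e i + f i, e) of (b, e) \<Rightarrow> (e, \<lambda>i. b i - e i)) = p"
      by simp
  qed
  also have "\<dots> = cauchy_prod x (cauchy_prod y z) a"
    unfolding cauchy_prod_def sum_distrib_left by (simp add: sum.Sigma)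
  finally show "cauchy_prod (cauchy_prod x y) z a = cauchy_prod x (cauchy_prod y z) a" .
qed

lemma conv_coeffs_add:
  assumes "conv_coeffs c" "conv_coeffs d"
  shows "conv_coeffs (\<lambda>a. c a + d a)"
proof -
  obtain r :: real where r: "r > 0"
    "(\<lambda>a. norm (c a) * r ^ (\<Sum>i\<in>UNIV. a i)) summable_on UNIV"
    "(\<lambda>a. norm (d a) * r ^ (\<Sum>i\<in>UNIV. a i)) summable_on UNIV"
    by (rule conv_coeffs_common_radius[OF assms])
  have "(\<lambda>a. norm (c a + d a) * r ^ (\<Sum>i\<in>UNIV. a i)) summable_on UNIV"
    by (rule summable_on_comparison_test[OF summable_on_add[OF r(2,3)]])
       (use r(1) in \<open>auto simp flip: distrib_right intro!: mult_right_mono norm_triangle_ineq\<close>)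
  with r(1) show ?thesis
    unfolding conv_coeffs_def by blast
qed

lemma conv_coeffs_uminus: "conv_coeffs c \<Longrightarrow> conv_coeffs (\<lambda>a. - c a)"
  by (simp add: conv_coeffs_def)

lemma conv_coeffs_const: "conv_coeffs (\<lambda>a. if a = (\<lambda>_. 0) then t else 0)"
proof -
  define g :: "('a \<Rightarrow> nat) \<Rightarrow> real"
    where "g = (\<lambda>a. norm (if a = (\<lambda>_. 0) then t else 0) * 1 ^ (\<Sum>i\<in>UNIV. a i))"
  have "g summable_on {\<lambda>_. 0}"
    by simp
  also have "?this \<longleftrightarrow> g summable_on UNIV"
    by (rule summable_on_cong_neutral) (auto simp: g_def)
  finally show ?thesis
    unfolding conv_coeffs_def g_def using zero_less_one by blast
qed

definition pderiv_coeffs :: "'n::finite \<Rightarrow> (('n \<Rightarrow> nat) \<Rightarrow> complex) \<Rightarrow> ('n \<Rightarrow> nat) \<Rightarrow> complex" where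
  "pderiv_coeffs i c a = of_nat (Suc (a i)) * c (a(i := Suc (a i)))"

lemma conv_coeffs_pderiv:
  fixes c :: "('n::finite \<Rightarrow> nat) \<Rightarrow> complex"
  assumes "conv_coeffs c"
  shows "conv_coeffs (pderiv_coeffs i c)"
proof -
  from assms obtain r :: real where r: "r > 0"
    "(\<lambda>a. norm (c a) * r ^ (\<Sum>j\<in>UNIV. a j)) summable_on UNIV"
    unfolding conv_coeffs_def by blast
  define s where "s a = a(i := Suc (a i))" for a :: "'n \<Rightarrow> nat"
  have "inj s"
    unfolding inj_def s_def by (metis fun_upd_idem_iff fun_upd_upd nat.inject fun_upd_same)
  have deg: "(\<Sum>j\<in>UNIV. s a j) = Suc (\<Sum>j\<in>UNIV. a j)" for a
    unfolding s_def by (simp add: sum.remove[of UNIV i])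
  have "(\<lambda>a. norm (c a) * r ^ (\<Sum>j\<in>UNIV. a j)) summable_on range s"
    using r(2) by (rule summable_on_subset_banach) simp
  then have "(\<lambda>a. norm (c (s a)) * r ^ (\<Sum>j\<in>UNIV. s a j)) summable_on UNIV"
    by (subst (asm) summable_on_reindex[OF \<open>inj s\<close>]) (simp add: o_def)
  then have "(\<lambda>a. inverse r * (norm (c (s a)) * r ^ (\<Sum>j\<in>UNIV. s a j))) summable_on UNIV"
    by (rule summable_on_cmult_right)
  then have sm: "(\<lambda>a. norm (c (s a)) * r ^ (\<Sum>j\<in>UNIV. a j)) summable_on UNIV"
    using r(1) by (simp add: deg field_simps)
  have "(\<lambda>a. norm (pderiv_coeffs i c a) * (r / 2) ^ (\<Sum>j\<in>UNIV. a j)) summable_on UNIV"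
  proof (rule summable_on_comparison_test[OF sm])
    fix a :: "'n \<Rightarrow> nat"
    have "a i \<le> (\<Sum>j\<in>UNIV. a j)"
      by (rule member_le_sum) auto
    then have "Suc (a i) \<le> 2 ^ (\<Sum>j\<in>UNIV. a j)"
      by (meson Suc_le_eq le_less_trans less_exp)
    then have le: "real (Suc (a i)) \<le> 2 ^ (\<Sum>j\<in>UNIV. a j)"
      by (metis of_nat_le_iff of_nat_numeral of_nat_power)
    have "norm (pderiv_coeffs i c a) * (r / 2) ^ (\<Sum>j\<in>UNIV. a j)
        = norm (c (s a)) * r ^ (\<Sum>j\<in>UNIV. a j) * (real (Suc (a i)) / 2 ^ (\<Sum>j\<in>UNIV. a j))"
      by (simp add: pderiv_coeffs_def s_def norm_mult power_divide del: of_nat_Suc)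
    also have "\<dots> \<le> norm (c (s a)) * r ^ (\<Sum>j\<in>UNIV. a j) * 1"
      using le r(1) by (intro mult_left_mono) auto
    finally show "norm (pderiv_coeffs i c a) * (r / 2) ^ (\<Sum>j\<in>UNIV. a j)
        \<le> norm (c (s a)) * r ^ (\<Sum>j\<in>UNIV. a j)" by simp
  qed (use r in auto)
  with r(1) show ?thesis
    unfolding conv_coeffs_def by (intro exI[of _ "r / 2"]) auto
qed

typedef (overloaded) 'n conv_series = "{c :: ('n::finite \<Rightarrow> nat) \<Rightarrow> complex. conv_coeffs c}"
  morphisms coeffs Abs_conv_series
  using conv_coeffs_const by blast

setup_lifting type_definition_conv_series

instantiation conv_series :: (finite) comm_ring_1
begin

lift_definition zero_conv_series :: "'a conv_series" is "\<lambda>_. 0"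
  using conv_coeffs_const[of 0] by simp

lift_definition one_conv_series :: "'a conv_series" is "\<lambda>a. if a = (\<lambda>_. 0) then 1 else 0"
  by (rule conv_coeffs_const)

lift_definition plus_conv_series :: "'a conv_series \<Rightarrow> 'a conv_series \<Rightarrow> 'a conv_series"
  is "\<lambda>c d a. c a + d a" by (rule conv_coeffs_add)

lift_definition uminus_conv_series :: "'a conv_series \<Rightarrow> 'a conv_series"
  is "\<lambda>c a. - c a" by (rule conv_coeffs_uminus)

lift_definition minus_conv_series :: "'a conv_series \<Rightarrow> 'a conv_series \<Rightarrow> 'a conv_series"
  is "\<lambda>c d a. c a - d a"
  using conv_coeffs_add[OF _ conv_coeffs_uminus] by simp

lift_definition times_conv_series :: "'a conv_series \<Rightarrow> 'a conv_series \<Rightarrow> 'a conv_series"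
  is cauchy_prod by (rule conv_coeffs_cauchy_prod)

instance
proof
  fix x y z :: "'a conv_series"
  show "x * y * z = x * (y * z)"
    by transfer (rule cauchy_prod_assoc)
  show "x * y = y * x"
    by transfer (rule cauchy_prod_commute)
  show "1 * x = x"
  proof transfer
    fix c :: "('a \<Rightarrow> nat) \<Rightarrow> complex"
    show "cauchy_prod (\<lambda>a. if a = (\<lambda>_. 0) then 1 else 0) c = c"
    proof
      fix a
      have "cauchy_prod (\<lambda>a. if a = (\<lambda>_. 0) then 1 else 0) c a
          = (\<Sum>b\<in>{..a}. if b = (\<lambda>_. 0) then c a else 0)"
        unfolding cauchy_prod_def by (rule sum.cong) auto
      also have "\<dots> = c a"
        by (subst sum.delta) (auto simp: le_fun_def)
      finally show "cauchy_prod (\<lambda>a. if a = (\<lambda>_. 0) then 1 else 0) c a = c a" .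
    qed
  qed
  show "(x + y) * z = x * z + y * z"
    by transfer (auto simp: cauchy_prod_def distrib_right sum.distrib)
  show "x + y + z = x + (y + z)"
    by transfer (simp add: add.assoc)
  show "x + y = y + x"
    by transfer (simp add: add.commute)
  show "0 + x = x" by transfer simp
  show "- x + x = 0" by transfer simp
  show "x - y = x + - y" by transfer simp
  show "(0 :: 'a conv_series) \<noteq> 1" by transfer (metis zero_neq_one)
qed

end

lift_definition partial_deriv :: "'n::finite \<Rightarrow> 'n conv_series \<Rightarrow> 'n conv_series"
  is pderiv_coeffs by (rule conv_coeffs_pderiv)

text \<open>
  The value of a series at a point. It is meaningful on a neighbourhood of the origin only, since
  \<^const>\<open>infsum\<close> is \<open>0\<close> where the series does not converge; it is used below under
  \<open>\<forall>\<^sub>F z in nhds 0\<close> only.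
\<close>

definition series_eval :: "'n::finite conv_series \<Rightarrow> complex ^ 'n \<Rightarrow> complex" where
  "series_eval f z = (\<Sum>\<^sub>\<infinity>a. coeffs f a * (\<Prod>i\<in>UNIV. z $ i ^ a i))"

abbreviation O_Y :: "'n::finite conv_series ring" where
  "O_Y \<equiv> ring_of_type_algebra"


section \<open>Commutative algebra\<close>

definition krull_dim :: "('a, 'b) ring_scheme \<Rightarrow> enat" where
  "krull_dim R = Sup {enat m | m. \<exists>P :: nat \<Rightarrow> 'a set.
     (\<forall>i\<le>m. primeideal (P i) R) \<and> (\<forall>i<m. P i \<subset> P (Suc i))}"

definition regular_sequence :: "('a, 'b) ring_scheme \<Rightarrow> 'a list \<Rightarrow> bool" where
  "regular_sequence R xs \<longleftrightarrow>
     set xs \<subseteq> carrier R \<and>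
     (\<forall>i<length xs. \<forall>a\<in>carrier R.
        a \<otimes>\<^bsub>R\<^esub> (xs ! i) \<in> Idl\<^bsub>R\<^esub> (set (take i xs)) \<longrightarrow> a \<in> Idl\<^bsub>R\<^esub> (set (take i xs))) \<and>
     Idl\<^bsub>R\<^esub> (set xs) \<noteq> carrier R"

text \<open>
  For a local ring the last condition of \<^const>\<open>regular_sequence\<close> forces the entries into the
  maximal ideal, so that the following is the usual depth.
\<close>

definition depth :: "('a, 'b) ring_scheme \<Rightarrow> enat" where
  "depth R = Sup {enat (length xs) | xs. regular_sequence R xs}"

definition cohen_macaulay_local :: "('a, 'b) ring_scheme \<Rightarrow> bool" where
  "cohen_macaulay_local R \<longleftrightarrow>
     cring R \<and> noetherian_ring R \<and> (\<exists>!m. maximalideal m R) \<and> depth R = krull_dim R"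

definition nonzerodivisors :: "('a, 'b) ring_scheme \<Rightarrow> 'a set" where
  "nonzerodivisors R =
     {s \<in> carrier R. \<forall>a\<in>carrier R. a \<otimes>\<^bsub>R\<^esub> s = \<zero>\<^bsub>R\<^esub> \<longrightarrow> a = \<zero>\<^bsub>R\<^esub>}"

text \<open>The fraction \<open>a / s\<close> as the class of all pairs representing it.\<close>

definition fraction :: "('a, 'b) ring_scheme \<Rightarrow> 'a \<Rightarrow> 'a \<Rightarrow> ('a \<times> 'a) set" where
  "fraction R a s =
     {(b, t). b \<in> carrier R \<and> t \<in> nonzerodivisors R \<and> a \<otimes>\<^bsub>R\<^esub> t = b \<otimes>\<^bsub>R\<^esub> s}"

text \<open>
  The total ring of fractions. The unions in the two operations range over families of equal
  classes, see \<open>total_fractions_mult\<close> and \<open>total_fractions_add\<close> below.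
\<close>

definition total_fractions :: "('a, 'b) ring_scheme \<Rightarrow> ('a \<times> 'a) set ring" where
  "total_fractions R =
     \<lparr>carrier = {fraction R a s | a s. a \<in> carrier R \<and> s \<in> nonzerodivisors R},
      monoid.mult = (\<lambda>p q. \<Union>(a, s)\<in>p. \<Union>(b, t)\<in>q. fraction R (a \<otimes>\<^bsub>R\<^esub> b) (s \<otimes>\<^bsub>R\<^esub> t)),
      one = fraction R \<one>\<^bsub>R\<^esub> \<one>\<^bsub>R\<^esub>,
      ring.zero = fraction R \<zero>\<^bsub>R\<^esub> \<one>\<^bsub>R\<^esub>,
      add = (\<lambda>p q. \<Union>(a, s)\<in>p. \<Union>(b, t)\<in>q.
        fraction R (a \<otimes>\<^bsub>R\<^esub> t \<oplus>\<^bsub>R\<^esub> b \<otimes>\<^bsub>R\<^esub> s) (s \<otimes>\<^bsub>R\<^esub> t))\<rparr>"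

lemma UN2_const:
  assumes "(a0, s0) \<in> P" "(b0, t0) \<in> Q"
    and "\<And>a s b t. (a, s) \<in> P \<Longrightarrow> (b, t) \<in> Q \<Longrightarrow> F a s b t = c"
  shows "(\<Union>(a, s)\<in>P. \<Union>(b, t)\<in>Q. F a s b t) = c"
proof -
  have "(\<Union>(a, s)\<in>P. \<Union>(b, t)\<in>Q. F a s b t) = (\<Union>x\<in>P. \<Union>y\<in>Q. c)"
    by (intro SUP_cong refl) (auto simp: assms(3) intro!: SUP_cong)
  also have "\<dots> = c"
    using assms(1,2) by (simp only: UN_constant) auto
  finally show ?thesis .
qed

lemma total_fractions_ops:
  "p \<otimes>\<^bsub>total_fractions R\<^esub> q =
     (\<Union>(a, s)\<in>p. \<Union>(b, t)\<in>q. fraction R (a \<otimes>\<^bsub>R\<^esub> b) (s \<otimes>\<^bsub>R\<^esub> t))"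
  "p \<oplus>\<^bsub>total_fractions R\<^esub> q =
     (\<Union>(a, s)\<in>p. \<Union>(b, t)\<in>q.
        fraction R (a \<otimes>\<^bsub>R\<^esub> t \<oplus>\<^bsub>R\<^esub> b \<otimes>\<^bsub>R\<^esub> s) (s \<otimes>\<^bsub>R\<^esub> t))"
  by (simp_all only: total_fractions_def monoid.select_convs ring.select_convs)

context cring
begin

lemma nonzerodivisors_closed: "s \<in> nonzerodivisors R \<Longrightarrow> s \<in> carrier R"
  by (simp add: nonzerodivisors_def)

lemma nonzerodivisors_mult:
  assumes "s \<in> nonzerodivisors R" "t \<in> nonzerodivisors R"
  shows "s \<otimes> t \<in> nonzerodivisors R"
proof -
  have c: "s \<in> carrier R" "t \<in> carrier R"
    using assms by (simp_all add: nonzerodivisors_closed)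
  have "a = \<zero>" if a: "a \<in> carrier R" "a \<otimes> (s \<otimes> t) = \<zero>" for a
  proof -
    have "(a \<otimes> s) \<otimes> t = \<zero>"
      using a c by (simp only: m_assoc)
    then have "a \<otimes> s = \<zero>"
      using assms(2) a(1) c by (simp add: nonzerodivisors_def)
    then show ?thesis
      using assms(1) a(1) by (simp add: nonzerodivisors_def)
  qed
  then show ?thesis
    using c by (simp add: nonzerodivisors_def)
qed

lemma nonzerodivisors_cancel:
  assumes "s \<in> nonzerodivisors R" "a \<in> carrier R" "b \<in> carrier R" "a \<otimes> s = b \<otimes> s"
  shows "a = b"
proof -
  have s: "s \<in> carrier R" using assms(1) by (simp add: nonzerodivisors_def)
  have "(a \<ominus> b) \<otimes> s = \<zero>"
    using assms s by (simp add: minus_eq l_distr l_minus r_neg)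
  then have "a \<ominus> b = \<zero>"
    using assms unfolding nonzerodivisors_def by auto
  then show ?thesis using assms by simp
qed

lemma fraction_eq_iff:
  assumes "s \<in> nonzerodivisors R" "t \<in> nonzerodivisors R" "a \<in> carrier R" "b \<in> carrier R"
  shows "fraction R a s = fraction R b t \<longleftrightarrow> a \<otimes> t = b \<otimes> s"
proof
  have c: "s \<in> carrier R" "t \<in> carrier R" using assms by (simp_all add: nonzerodivisors_closed)
  show "a \<otimes> t = b \<otimes> s" if "fraction R a s = fraction R b t"
  proof -
    have "(b, t) \<in> fraction R b t" using assms by (auto simp: fraction_def)
    then show ?thesis using that by (auto simp: fraction_def)
  qed
  have sub: "fraction R a s \<subseteq> fraction R b t"
    if st: "s \<in> nonzerodivisors R" "t \<in> nonzerodivisors R" and ab: "a \<in> carrier R" "b \<in> carrier R"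
      and eq: "a \<otimes> t = b \<otimes> s" for a b s t
  proof (clarsimp simp: fraction_def)
    fix d u assume d: "d \<in> carrier R" "u \<in> nonzerodivisors R" "a \<otimes> u = d \<otimes> s"
    have c: "s \<in> carrier R" "t \<in> carrier R" "u \<in> carrier R"
      using st d(2) by (simp_all add: nonzerodivisors_closed)
    have "(b \<otimes> u) \<otimes> s = (b \<otimes> s) \<otimes> u" using ab c by (simp add: m_ac)
    also have "\<dots> = (a \<otimes> t) \<otimes> u" by (simp only: eq)
    also have "\<dots> = (a \<otimes> u) \<otimes> t" using ab c by (simp add: m_ac)
    also have "\<dots> = (d \<otimes> s) \<otimes> t" by (simp only: d(3))
    also have "\<dots> = (d \<otimes> t) \<otimes> s" using d(1) c by (simp add: m_ac)
    finally show "b \<otimes> u = d \<otimes> t"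
      using nonzerodivisors_cancel[OF st(1)] ab c d(1) by (meson m_closed)
  qed
  show "fraction R a s = fraction R b t" if "a \<otimes> t = b \<otimes> s"
    using sub[of s t a b] sub[of t s b a] that assms by auto
qed

lemma total_fractions_mult:
  assumes "a \<in> carrier R" "b \<in> carrier R" "s \<in> nonzerodivisors R" "t \<in> nonzerodivisors R"
  shows "fraction R a s \<otimes>\<^bsub>total_fractions R\<^esub> fraction R b t = fraction R (a \<otimes> b) (s \<otimes> t)"
proof -
  have eq: "fraction R (a' \<otimes> b') (s' \<otimes> t') = fraction R (a \<otimes> b) (s \<otimes> t)"
    if "(a', s') \<in> fraction R a s" "(b', t') \<in> fraction R b t" for a' s' b' t'
  proof -
    have m: "a' \<in> carrier R" "b' \<in> carrier R" "s' \<in> nonzerodivisors R" "t' \<in> nonzerodivisors R"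
      "a \<otimes> s' = a' \<otimes> s" "b \<otimes> t' = b' \<otimes> t"
      using that by (auto simp: fraction_def)
    have c: "s \<in> carrier R" "t \<in> carrier R" "s' \<in> carrier R" "t' \<in> carrier R"
      using m(3,4) assms by (simp_all add: nonzerodivisors_closed)
    have "(a' \<otimes> b') \<otimes> (s \<otimes> t) = (a' \<otimes> s) \<otimes> (b' \<otimes> t)" using m(1,2) c by (simp add: m_ac)
    also have "\<dots> = (a \<otimes> s') \<otimes> (b \<otimes> t')" by (simp only: m(5,6))
    also have "\<dots> = (a \<otimes> b) \<otimes> (s' \<otimes> t')" using assms c by (simp add: m_ac)
    finally show ?thesis
      using m(1-4) assms c by (simp add: fraction_eq_iff nonzerodivisors_mult)
  qed
  have mem: "(a, s) \<in> fraction R a s" "(b, t) \<in> fraction R b t"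
    using assms by (auto simp: fraction_def)
  show ?thesis
    unfolding total_fractions_ops(1) by (rule UN2_const[OF mem]) (rule eq)
qed

lemma total_fractions_add:
  assumes "a \<in> carrier R" "b \<in> carrier R" "s \<in> nonzerodivisors R" "t \<in> nonzerodivisors R"
  shows "fraction R a s \<oplus>\<^bsub>total_fractions R\<^esub> fraction R b t
       = fraction R (a \<otimes> t \<oplus> b \<otimes> s) (s \<otimes> t)"
proof -
  have eq: "fraction R (a' \<otimes> t' \<oplus> b' \<otimes> s') (s' \<otimes> t') = fraction R (a \<otimes> t \<oplus> b \<otimes> s) (s \<otimes> t)"
    if "(a', s') \<in> fraction R a s" "(b', t') \<in> fraction R b t" for a' s' b' t'
  proof -
    have m: "a' \<in> carrier R" "b' \<in> carrier R" "s' \<in> nonzerodivisors R" "t' \<in> nonzerodivisors R"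
      "a \<otimes> s' = a' \<otimes> s" "b \<otimes> t' = b' \<otimes> t"
      using that by (auto simp: fraction_def)
    have c: "s \<in> carrier R" "t \<in> carrier R" "s' \<in> carrier R" "t' \<in> carrier R"
      using m(3,4) assms by (simp_all add: nonzerodivisors_closed)
    have "(a' \<otimes> t' \<oplus> b' \<otimes> s') \<otimes> (s \<otimes> t) = (a' \<otimes> s) \<otimes> (t \<otimes> t') \<oplus> (b' \<otimes> t) \<otimes> (s \<otimes> s')"
      using m(1,2) c by (simp add: m_ac l_distr r_distr)
    also have "\<dots> = (a \<otimes> s') \<otimes> (t \<otimes> t') \<oplus> (b \<otimes> t') \<otimes> (s \<otimes> s')"
      by (simp only: m(5,6))
    also have "\<dots> = (a \<otimes> t \<oplus> b \<otimes> s) \<otimes> (s' \<otimes> t')"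
      using assms c by (simp add: m_ac l_distr r_distr)
    finally show ?thesis
      using m(1-4) assms c by (simp add: fraction_eq_iff nonzerodivisors_mult)
  qed
  have mem: "(a, s) \<in> fraction R a s" "(b, t) \<in> fraction R b t"
    using assms by (auto simp: fraction_def)
  show ?thesis
    unfolding total_fractions_ops(2) by (rule UN2_const[OF mem]) (rule eq)
qed

end


section \<open>Reduced analytic germs\<close>

text \<open>
  A reduced analytic germ at the origin is given by a representative of its underlying set germ;
  its structure ring is the ring of series modulo those vanishing on the set near the origin.
\<close>

definition analytic_germ :: "(complex ^ 'n::finite) set \<Rightarrow> bool" where
  "analytic_germ Z \<longleftrightarrow> 0 \<in> Z \<and>
     (\<exists>F. finite F \<and> (\<forall>\<^sub>F z in nhds 0. z \<in> Z \<longleftrightarrow> (\<forall>f\<in>F. series_eval f z = 0)))"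

definition germ_subset :: "(complex ^ 'n::finite) set \<Rightarrow> (complex ^ 'n) set \<Rightarrow> bool" where
  "germ_subset V C \<longleftrightarrow> (\<forall>\<^sub>F z in nhds 0. z \<in> V \<longrightarrow> z \<in> C)"

definition germ_ideal :: "(complex ^ 'n::finite) set \<Rightarrow> 'n conv_series set" where
  "germ_ideal Z = {f. \<forall>\<^sub>F z in nhds 0. z \<in> Z \<longrightarrow> series_eval f z = 0}"

abbreviation structure_ring :: "(complex ^ 'n::finite) set \<Rightarrow> 'n conv_series set ring" where
  "structure_ring Z \<equiv> O_Y Quot germ_ideal Z"

abbreviation germ_res :: "(complex ^ 'n::finite) set \<Rightarrow> 'n conv_series \<Rightarrow> 'n conv_series set" where
  "germ_res Z f \<equiv> germ_ideal Z +>\<^bsub>O_Y\<^esub> f"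

definition germ_codim :: "(complex ^ 'n::finite) set \<Rightarrow> nat \<Rightarrow> bool" where
  "germ_codim Z k \<longleftrightarrow> krull_dim (structure_ring Z) + enat k = enat CARD('n)"

text \<open>
  As \<open>germ_ideal C\<close> consists of all series vanishing on \<open>C\<close>, the last condition includes that the
  complete intersection defined by \<open>hs\<close> is reduced.
\<close>

definition complete_intersection :: "(complex ^ 'n::finite) set \<Rightarrow> 'n conv_series list \<Rightarrow> bool" where
  "complete_intersection C hs \<longleftrightarrow>
     analytic_germ C \<and> regular_sequence O_Y hs \<and> germ_ideal C = Idl\<^bsub>O_Y\<^esub> (set hs)"


section \<open>Differential forms and multivector fields\<close>

text \<open>
  An element of the exterior algebra of forms is given by its coordinates with respect to
  the basis \<open>dx\<^sub>J = dx\<^sub>j\<^sub>1 \<and> \<dots> \<and> dx\<^sub>j\<^sub>q\<close>, where \<open>J = {j\<^sub>1 < \<dots> < j\<^sub>q}\<close>; likewise for multivector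
  fields and the dual basis. The degree in \<open>Omega\<close> is an integer, so that there are no nonzero
  forms of negative degree.
\<close>

type_synonym 'n form = "'n set \<Rightarrow> 'n conv_series"

definition Omega :: "int \<Rightarrow> 'n::{finite,linorder} form set" where
  "Omega p = {\<omega>. \<forall>J. int (card J) \<noteq> p \<longrightarrow> \<omega> J = 0}"

definition Theta :: "nat \<Rightarrow> 'n::{finite,linorder} form set" where
  "Theta q = {\<delta>. \<forall>J. card J \<noteq> q \<longrightarrow> \<delta> J = 0}"

definition pairing :: "'n::{finite,linorder} form \<Rightarrow> 'n form \<Rightarrow> 'n conv_series" where
  "pairing \<delta> \<omega> = (\<Sum>J\<in>UNIV. \<delta> J * \<omega> J)"

text \<open>\<open>dx\<^sub>I \<and> dx\<^sub>J = shuffle_sign I J dx\<^sub>I\<^sub>\<union>\<^sub>J\<close> for disjoint \<open>I\<close> and \<open>J\<close>.\<close>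

definition shuffle_sign :: "'n::{finite,linorder} set \<Rightarrow> 'n set \<Rightarrow> 'n conv_series" where
  "shuffle_sign I J = (-1) ^ card {(i, j). i \<in> I \<and> j \<in> J \<and> j < i}"

definition wedge :: "'n::{finite,linorder} form \<Rightarrow> 'n form \<Rightarrow> 'n form" where
  "wedge \<omega> \<eta> = (\<lambda>K. \<Sum>I\<in>Pow K. shuffle_sign I (K - I) * \<omega> I * \<eta> (K - I))"

definition differential :: "'n::{finite,linorder} conv_series \<Rightarrow> 'n form" where
  "differential f = (\<lambda>J. \<Sum>i\<in>UNIV. if J = {i} then partial_deriv i f else 0)"

text \<open>\<open>df\<^sub>1 \<and> \<dots> \<and> df\<^sub>k\<close>, the empty product being \<open>1\<close>.\<close>

definition wedge_differentials :: "'n::{finite,linorder} conv_series list \<Rightarrow> 'n form" where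
  "wedge_differentials fs =
     foldr (\<lambda>f. wedge (differential f)) fs (\<lambda>J. if J = {} then 1 else 0)"


section \<open>Multi-logarithmic vector fields and fundamental forms\<close>

text \<open>Finite sums of forms \<open>df\<^sub>1 \<and> \<dots> \<and> df\<^sub>k \<and> \<xi>\<close> of degree \<open>q\<close> with \<open>f\<^sub>i\<close> in the ideal of \<open>Z\<close>.\<close>

definition log_test_forms ::
  "(complex ^ 'n::{finite,linorder}) set \<Rightarrow> nat \<Rightarrow> nat \<Rightarrow> 'n form set" where
  "log_test_forms Z k q =
     {(\<lambda>J. \<Sum>l<m. wedge (wedge_differentials (fs l)) (\<xi> l) J) | m fs \<xi>.
        \<forall>l<(m::nat). length (fs l) = k \<and> set (fs l) \<subseteq> germ_ideal Z \<and> \<xi> l \<in> Omega (int q - int k)}"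

definition Der_log ::
  "(complex ^ 'n::{finite,linorder}) set \<Rightarrow> nat \<Rightarrow> nat \<Rightarrow> 'n form set" where
  "Der_log Z k q = {\<delta> \<in> Theta q. \<forall>\<omega>\<in>log_test_forms Z k q. pairing \<delta> \<omega> \<in> germ_ideal Z}"

abbreviation total_fractions_of :: "(complex ^ 'n::finite) set \<Rightarrow>
    ('n conv_series set \<times> 'n conv_series set) set ring" where
  "total_fractions_of Z \<equiv> total_fractions (structure_ring Z)"

text \<open>
  The graph of the canonical map from the total ring of fractions of \<open>C\<close> to that of a germ
  \<open>Z \<subseteq> C\<close>, induced by restriction of functions: \<open>a / s\<close> is sent to \<open>a\<bar>\<^sub>Z / s\<bar>\<^sub>Z\<close>.
\<close>

definition fraction_restricts_to ::
  "(complex ^ 'n::finite) set \<Rightarrow> (complex ^ 'n) set \<Rightarrow>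
   ('n conv_series set \<times> 'n conv_series set) set \<Rightarrow>
   ('n conv_series set \<times> 'n conv_series set) set \<Rightarrow> bool" where
  "fraction_restricts_to C Z p p' \<longleftrightarrow>
     (\<exists>a s. germ_res C s \<in> nonzerodivisors (structure_ring C) \<and>
            germ_res Z s \<in> nonzerodivisors (structure_ring Z) \<and>
            p = fraction (structure_ring C) (germ_res C a) (germ_res C s) \<and>
            p' = fraction (structure_ring Z) (germ_res Z a) (germ_res Z s))"

text \<open>
  \<open>e\<close> is the element \<open>(1, 0)\<close> under the canonical isomorphism from the total ring of fractions
  of \<open>C\<close> to the product of those of \<open>V\<close> and \<open>V' = closure (C - V)\<close>.
\<close>

definition is_indicator ::
  "(complex ^ 'n::finite) set \<Rightarrow> (complex ^ 'n) set \<Rightarrow>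
   ('n conv_series set \<times> 'n conv_series set) set \<Rightarrow> bool" where
  "is_indicator C V e \<longleftrightarrow>
     fraction_restricts_to C V e \<one>\<^bsub>total_fractions_of V\<^esub> \<and>
     fraction_restricts_to C (closure (C - V)) e \<zero>\<^bsub>total_fractions_of (closure (C - V))\<^esub>"

definition to_total_fractions ::
  "(complex ^ 'n::finite) set \<Rightarrow> 'n conv_series \<Rightarrow>
   ('n conv_series set \<times> 'n conv_series set) set" where
  "to_total_fractions Z f =
     fraction (structure_ring Z) (germ_res Z f) \<one>\<^bsub>structure_ring Z\<^esub>"

text \<open>
  Since the module of forms is free, equality after tensoring with the total ring of fractions of
  \<open>C\<close> is equality of all coordinates.
\<close>

definition fundamental_form ::
  "(complex ^ 'n::{finite,linorder}) set \<Rightarrow> 'n conv_series list \<Rightarrow>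
   (complex ^ 'n::{finite,linorder}) set \<Rightarrow> 'n form \<Rightarrow> bool" where
  "fundamental_form C hs V \<alpha> \<longleftrightarrow>
     \<alpha> \<in> Omega (int (length hs)) \<and>
     (\<exists>e. is_indicator C V e \<and>
        (\<forall>J. to_total_fractions C (\<alpha> J) =
             e \<otimes>\<^bsub>total_fractions_of C\<^esub> to_total_fractions C (wedge_differentials hs J)))"

end

theory Submission
  imports Defs
begin

text \<open>
  Write \<open>I\<^sub>Z\<close> for \<^term>\<open>germ_ideal Z\<close>, \<open>V'\<close> for the closure of \<open>C - V\<close>, and \<open>dh\<close> for
  \<open>dh\<^sub>1 \<and> \<dots> \<and> dh\<^sub>k\<close>. The element \<open>(1, 0)\<close> of the total ring of fractions of \<open>C\<close> is
  represented by fractions \<open>a / s\<close> and \<open>b / t\<close>, where \<open>a\<close> and \<open>s\<close> agree on \<open>V\<close>, \<open>s\<close> is a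
  nonzerodivisor there, and \<open>b\<close> vanishes on \<open>V'\<close>. Clearing denominators turns the definition of a
  fundamental form into congruences between series (lemma \<open>fundamental_form_congruences\<close>):
  on \<open>V\<close> the form \<open>\<alpha>\<close> coincides with \<open>dh\<close>, while \<open>\<alpha>\<close> and \<open>a\<close> multiply \<open>I\<^sub>V\<close> into \<open>I\<^sub>C\<close>, because
  they vanish on the part of \<open>C\<close> outside \<open>V\<close>.

  Three of the four comparisons follow at once. Pairing with \<open>\<alpha> \<and> \<xi>\<close> or with \<open>dh \<and> \<xi>\<close> gives the
  same result modulo \<open>I\<^sub>V\<close>, and \<open>dh \<and> \<xi>\<close> is a test form for both \<open>C\<close> and \<open>V\<close>, so logarithmic
  fields along either germ satisfy the condition \<open>\<langle>\<delta>, \<alpha> \<and> \<xi>\<rangle> \<in> I\<^sub>V\<close>. If \<open>p = \<langle>\<delta>, \<alpha> \<and> \<xi>\<rangle>\<close> lies in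
  \<open>I\<^sub>V\<close>, then \<open>p\<^sup>2 = \<langle>\<delta>, p\<alpha> \<and> \<xi>\<rangle>\<close> lies in \<open>I\<^sub>C\<close>, hence so does \<open>p\<close>, as \<open>I\<^sub>C\<close> is radical.

  The remaining inclusion must control \<open>df\<^sub>1 \<and> \<dots> \<and> df\<^sub>k\<close> for all \<open>f\<^sub>i \<in> I\<^sub>V\<close>. Here \<open>a f\<^sub>i\<close> lies in
  \<open>I\<^sub>C = (h\<^sub>1, \<dots>, h\<^sub>k)\<close>; differentiating an expression \<open>a f\<^sub>i = \<Sum>\<^sub>j c\<^sub>i\<^sub>j h\<^sub>j\<close> gives
  \<open>a df\<^sub>i \<equiv> \<Sum>\<^sub>j c\<^sub>i\<^sub>j dh\<^sub>j\<close> modulo \<open>I\<^sub>V\<close>. Taking the wedge product of these \<open>k\<close> congruences,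
  \<open>a\<^sup>k df\<^sub>1 \<and> \<dots> \<and> df\<^sub>k\<close> is congruent to a multiple of \<open>dh\<close>, namely by \<open>det (c\<^sub>i\<^sub>j)\<close>
  (lemma \<open>wedge_differentials_proportional\<close>). So \<open>a\<^sup>k\<close> times the pairing in question lies in \<open>I\<^sub>V\<close>,
  and \<open>a\<close>, which agrees with \<open>s\<close> on \<open>V\<close>, can be cancelled.
\<close>


section \<open>Derivatives and values of convergent series\<close>

lemma partial_deriv_add: "partial_deriv i (f + g) = partial_deriv i f + partial_deriv i g"
  by transfer (auto simp: pderiv_coeffs_def algebra_simps)

text \<open>
  In the coefficient of index \<open>a\<close> on the left, the factor \<open>a\<^sub>i + 1\<close> is the \<open>i\<close>-th entry of the index
  \<open>s a = a + e\<^sub>i\<close> of the product. It splits as \<open>b\<^sub>i + (a\<^sub>i + 1 - b\<^sub>i)\<close> for every term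
  \<open>c b * d (s a - b)\<close>; the two parts are the contributions of the two products on the right.
\<close>

lemma pderiv_coeffs_cauchy_prod:
  "pderiv_coeffs i (cauchy_prod c d) a =
     cauchy_prod (pderiv_coeffs i c) d a + cauchy_prod c (pderiv_coeffs i d) a"
proof -
  define s where "s b = b(i := Suc (b i))" for b :: "'a \<Rightarrow> nat"
  have s_le: "s b \<le> s a \<longleftrightarrow> b \<le> a" for b
    unfolding s_def le_fun_def by (metis Suc_le_mono fun_upd_apply)
  have "pderiv_coeffs i (cauchy_prod c d) a =
      (\<Sum>b\<in>{..s a}. of_nat (Suc (a i)) * (c b * d (\<lambda>j. s a j - b j)))"
    by (simp add: pderiv_coeffs_def cauchy_prod_def s_def sum_distrib_left del: of_nat_Suc)
  also have "\<dots> = (\<Sum>b\<in>{..s a}. of_nat (b i) * (c b * d (\<lambda>j. s a j - b j))) +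
      (\<Sum>b\<in>{..s a}. of_nat (s a i - b i) * (c b * d (\<lambda>j. s a j - b j)))"
  proof -
    have "Suc (a i) = b i + (s a i - b i)" if "b \<le> s a" for b
      using le_funD[OF that, of i] by (simp add: s_def)
    then show ?thesis
      unfolding sum.distrib[symmetric] distrib_right[symmetric] of_nat_add[symmetric]
      by (intro sum.cong) auto
  qed
  \<comment> \<open>Indices with \<open>b\<^sub>i = 0\<close> contribute nothing, and the others are those of the form \<open>s b'\<close>.\<close>
  also have "(\<Sum>b\<in>{..s a}. of_nat (b i) * (c b * d (\<lambda>j. s a j - b j))) =
      (\<Sum>b\<in>s ` {..a}. of_nat (b i) * (c b * d (\<lambda>j. s a j - b j)))"
  proof (rule sum.mono_neutral_right)
    show "\<forall>b\<in>{..s a} - s ` {..a}. of_nat (b i) * (c b * d (\<lambda>j. s a j - b j)) = 0"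
    proof
      fix b assume b: "b \<in> {..s a} - s ` {..a}"
      have "b i = 0"
      proof (rule ccontr)
        assume "b i \<noteq> 0"
        then have "b = s (b(i := b i - 1))" by (auto simp: s_def)
        then show False using b s_le by (metis DiffE atMost_iff imageI)
      qed
      then show "of_nat (b i) * (c b * d (\<lambda>j. s a j - b j)) = 0" by simp
    qed
  qed (auto simp: s_le)
  also have "\<dots> = cauchy_prod (pderiv_coeffs i c) d a"
  proof (subst sum.reindex)
    show "inj_on s {..a}"
      unfolding inj_on_def s_def by (metis fun_upd_idem_iff fun_upd_upd nat.inject fun_upd_same)
    have "(\<lambda>j. s a j - s b j) = (\<lambda>j. a j - b j)" for b
      by (auto simp: s_def)
    then show "sum ((\<lambda>b. of_nat (b i) * (c b * d (\<lambda>j. s a j - b j))) \<circ> s) {..a} =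
        cauchy_prod (pderiv_coeffs i c) d a"
      by (simp add: cauchy_prod_def pderiv_coeffs_def mult.assoc s_def del: of_nat_Suc)
  qed
  \<comment> \<open>Here the terms with \<open>b\<^sub>i = a\<^sub>i + 1\<close> vanish.\<close>
  also have "(\<Sum>b\<in>{..s a}. of_nat (s a i - b i) * (c b * d (\<lambda>j. s a j - b j))) =
      (\<Sum>b\<in>{..a}. of_nat (s a i - b i) * (c b * d (\<lambda>j. s a j - b j)))"
  proof (rule sum.mono_neutral_right)
    have "a \<le> s a" by (simp add: le_fun_def s_def)
    then show "{..a} \<subseteq> {..s a}" by simp
    show "\<forall>b\<in>{..s a} - {..a}. of_nat (s a i - b i) * (c b * d (\<lambda>j. s a j - b j)) = 0"
    proof
      fix b assume b: "b \<in> {..s a} - {..a}"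
      have "s a i \<le> b i"
      proof (rule ccontr)
        assume "\<not> s a i \<le> b i"
        then have "b j \<le> a j" for j
          using b by (cases "j = i") (auto simp: s_def le_fun_def split: if_splits)
        then show False using b by (simp add: le_fun_def)
      qed
      then show "of_nat (s a i - b i) * (c b * d (\<lambda>j. s a j - b j)) = 0" by simp
    qed
  qed auto
  also have "\<dots> = cauchy_prod c (pderiv_coeffs i d) a"
    unfolding cauchy_prod_def
  proof (rule sum.cong)
    fix b assume "b \<in> {..a}"
    then have "Suc (a i) - b i = Suc (a i - b i)"
      by (simp add: le_fun_def Suc_diff_le)
    moreover from this have "(\<lambda>j. s a j - b j) = (\<lambda>j. a j - b j)(i := Suc (a i - b i))"
      by (auto simp: s_def)
    ultimately show "of_nat (s a i - b i) * (c b * d (\<lambda>j. s a j - b j)) =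
        c b * pderiv_coeffs i d (\<lambda>j. a j - b j)"
      by (simp add: pderiv_coeffs_def s_def del: of_nat_Suc)
  qed simp
  finally show ?thesis .
qed

lemma partial_deriv_mult:
  "partial_deriv i (f * g) = partial_deriv i f * g + f * partial_deriv i g"
  by (simp add: coeffs_inject[symmetric] fun_eq_iff partial_deriv.rep_eq times_conv_series.rep_eq
      plus_conv_series.rep_eq pderiv_coeffs_cauchy_prod)

definition monomial_at :: "complex ^ 'n::finite \<Rightarrow> ('n \<Rightarrow> nat) \<Rightarrow> complex" where
  "monomial_at z a = (\<Prod>i\<in>UNIV. z $ i ^ a i)"

lemma eventually_abs_summable:
  fixes f :: "'n::finite conv_series"
  shows "\<forall>\<^sub>F z in nhds 0. (\<lambda>a. norm (coeffs f a * monomial_at z a)) summable_on UNIV"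
proof -
  have "conv_coeffs (coeffs f)" using coeffs[of f] by simp
  then obtain r :: real where r: "r > 0"
    "(\<lambda>a. norm (coeffs f a) * r ^ (\<Sum>i\<in>UNIV. a i)) summable_on UNIV"
    unfolding conv_coeffs_def by blast
  have "\<forall>\<^sub>F z in nhds (0 :: complex ^ 'n). norm z < r"
    unfolding eventually_nhds_metric using r(1) by (metis dist_0_norm dist_commute)
  then show ?thesis
  proof eventually_elim
    case (elim z)
    have le: "norm (monomial_at z a) \<le> r ^ (\<Sum>i\<in>UNIV. a i)" for a
    proof -
      have zi: "norm (z $ i) \<le> r" for i
        using Finite_Cartesian_Product.norm_nth_le[of z i] elim by simp
      have "norm (monomial_at z a) = (\<Prod>i\<in>UNIV. norm (z $ i) ^ a i)"
        by (simp add: monomial_at_def norm_power flip: prod_norm)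
      also have "\<dots> \<le> (\<Prod>i\<in>UNIV. r ^ a i)"
        by (intro prod_mono conjI power_mono zi) auto
      also have "\<dots> = r ^ (\<Sum>i\<in>UNIV. a i)"
        by (simp add: power_sum)
      finally show ?thesis .
    qed
    show ?case
      by (rule summable_on_comparison_test[OF r(2)])
         (auto simp: norm_mult intro!: mult_left_mono le)
  qed
qed

lemma series_eval_add_nhds:
  fixes f g :: "'n::finite conv_series"
  shows "\<forall>\<^sub>F z in nhds 0. series_eval (f + g) z = series_eval f z + series_eval g z"
  using eventually_abs_summable[of f] eventually_abs_summable[of g]
proof eventually_elim
  case (elim z)
  have "series_eval (f + g) z =
      (\<Sum>\<^sub>\<infinity>a. coeffs f a * monomial_at z a + coeffs g a * monomial_at z a)"
    by (simp add: series_eval_def monomial_at_def plus_conv_series.rep_eq distrib_right)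
  also have "\<dots> = (\<Sum>\<^sub>\<infinity>a. coeffs f a * monomial_at z a) + (\<Sum>\<^sub>\<infinity>a. coeffs g a * monomial_at z a)"
    using elim by (intro infsum_add) (rule abs_summable_summable; simp)+
  finally show ?case
    by (simp add: series_eval_def monomial_at_def)
qed

text \<open>
  Where both series converge absolutely, the product family of their terms is absolutely summable and
  may be summed along the fibres of \<open>(b, e) \<mapsto> b + e\<close>, which produces the Cauchy product.
\<close>

lemma series_eval_mult_nhds:
  fixes f g :: "'n::finite conv_series"
  shows "\<forall>\<^sub>F z in nhds 0. series_eval (f * g) z = series_eval f z * series_eval g z"
  using eventually_abs_summable[of f] eventually_abs_summable[of g]
proof eventually_elim
  case (elim z)
  define p where "p a = coeffs f a * monomial_at z a" for a
  define q where "q a = coeffs g a * monomial_at z a" for a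
  have sm: "(\<lambda>a. norm (p a)) summable_on UNIV" "(\<lambda>a. norm (q a)) summable_on UNIV"
    using elim by (simp_all add: p_def q_def)
  have "(\<lambda>x. norm (case x of (b, e) \<Rightarrow> p b * q e)) summable_on UNIV \<times> UNIV"
    by (rule Infinite_Sum.abs_summable_on_Sigma_iff[THEN iffD2])
       (simp add: norm_mult infsum_cmult_right' abs_mult summable_on_cmult_right
        summable_on_cmult_left sm)
  then have psm: "(\<lambda>(b, e). p b * q e) summable_on UNIV \<times> UNIV"
    by (rule abs_summable_summable)
  have mono: "monomial_at z b * monomial_at z (\<lambda>i. a i - b i) = monomial_at z a" if "b \<le> a" for a b
    using that by (simp add: monomial_at_def le_fun_def flip: prod.distrib power_add)
  have bij: "bij_betw (\<lambda>(a, b). (b, \<lambda>i. a i - b i)) (SIGMA a:UNIV. {..a})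
      (UNIV \<times> (UNIV :: ('n \<Rightarrow> nat) set))"
    by (rule bij_betwI[where g = "\<lambda>(b, e). (\<lambda>i. b i + e i, b)"]) (auto simp: le_fun_def)
  have "series_eval f z * series_eval g z = (\<Sum>\<^sub>\<infinity>b. p b * (\<Sum>\<^sub>\<infinity>e. q e))"
    by (simp add: series_eval_def p_def[abs_def] q_def[abs_def] monomial_at_def infsum_cmult_left')
  also have "\<dots> = (\<Sum>\<^sub>\<infinity>b. \<Sum>\<^sub>\<infinity>e. p b * q e)"
    by (simp add: infsum_cmult_right')
  also have "\<dots> = infsum (\<lambda>(b, e). p b * q e) (UNIV \<times> UNIV)"
    using infsum_Sigma_banach[OF psm] by simp
  also have "\<dots> = infsum (\<lambda>(a, b). p b * q (\<lambda>i. a i - b i)) (SIGMA a:UNIV. {..a})"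
    by (subst infsum_reindex_bij_betw[OF bij, symmetric]) (simp add: case_prod_unfold)
  also have "\<dots> = (\<Sum>\<^sub>\<infinity>a. \<Sum>\<^sub>\<infinity>b\<in>{..a}. p b * q (\<lambda>i. a i - b i))"
  proof -
    have "(\<lambda>(a, b). p b * q (\<lambda>i. a i - b i)) summable_on (SIGMA a:UNIV. {..a})"
      using psm by (subst (asm) summable_on_reindex_bij_betw[OF bij, symmetric])
        (simp add: case_prod_unfold)
    from infsum_Sigma_banach[OF this] show ?thesis by simp
  qed
  also have "\<dots> = (\<Sum>\<^sub>\<infinity>a. coeffs (f * g) a * monomial_at z a)"
  proof (rule infsum_cong)
    fix a :: "'n \<Rightarrow> nat"
    have "p b * q (\<lambda>i. a i - b i) = coeffs f b * coeffs g (\<lambda>i. a i - b i) * monomial_at z a"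
      if "b \<le> a" for b
      by (simp add: p_def q_def mult_ac mono[OF that, symmetric])
    then show "(\<Sum>\<^sub>\<infinity>b\<in>{..a}. p b * q (\<lambda>i. a i - b i)) = coeffs (f * g) a * monomial_at z a"
      by (simp add: times_conv_series.rep_eq cauchy_prod_def sum_distrib_right)
  qed
  finally show ?case
    by (simp add: series_eval_def monomial_at_def)
qed


section \<open>Ideals of convergent series and their quotients\<close>

lemma ideal_O_Y_iff:
  "ideal I O_Y \<longleftrightarrow> 0 \<in> I \<and> (\<forall>x\<in>I. \<forall>y\<in>I. x + y \<in> I) \<and> (\<forall>x\<in>I. \<forall>r. r * x \<in> I)"
proof
  assume "ideal I O_Y"
  then interpret ideal I O_Y .
  have ops: "monoid.mult O_Y = (*)" "add O_Y = (+)" "ring.zero O_Y = 0" "carrier O_Y = UNIV"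
    by (auto simp: ring_of_type_algebra_def)
  show "0 \<in> I \<and> (\<forall>x\<in>I. \<forall>y\<in>I. x + y \<in> I) \<and> (\<forall>x\<in>I. \<forall>r. r * x \<in> I)"
    using additive_subgroup.zero_closed[OF additive_subgroup_axioms]
      additive_subgroup.a_closed[OF additive_subgroup_axioms] I_l_closed by (simp add: ops)
next
  assume *: "0 \<in> I \<and> (\<forall>x\<in>I. \<forall>y\<in>I. x + y \<in> I) \<and> (\<forall>x\<in>I. \<forall>r. r * x \<in> I)"
  interpret cring O_Y by (rule cring_from_type_algebra)
  have ops: "monoid.mult O_Y = (*)" "add O_Y = (+)" "ring.zero O_Y = 0" "carrier O_Y = UNIV"
    by (auto simp: ring_of_type_algebra_def)
  have minus: "- x \<in> I" if "x \<in> I" for x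
    using * that by (metis mult_minus1)
  have inv: "inv\<^bsub>add_monoid O_Y\<^esub> x = - x" for x
    unfolding a_inv_def[symmetric] by (rule minus_equality) (simp_all add: ops)
  show "ideal I O_Y"
  proof (rule idealI)
    show "subgroup I (add_monoid O_Y)"
      by (rule subgroup.intro) (use * minus in \<open>simp_all only: inv, simp_all add: ops\<close>)
  qed (use * in \<open>auto simp: ops mult.commute intro: ring_axioms\<close>)
qed

lemma ideal_zero: "ideal I O_Y \<Longrightarrow> 0 \<in> I"
  and ideal_add: "ideal I O_Y \<Longrightarrow> x \<in> I \<Longrightarrow> y \<in> I \<Longrightarrow> x + y \<in> I"
  and ideal_mult_left: "ideal I O_Y \<Longrightarrow> x \<in> I \<Longrightarrow> r * x \<in> I"
  and ideal_mult_right: "ideal I O_Y \<Longrightarrow> x \<in> I \<Longrightarrow> x * r \<in> I"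
  by (simp_all add: ideal_O_Y_iff) (metis mult.commute)

lemma ideal_diff: "ideal I O_Y \<Longrightarrow> x \<in> I \<Longrightarrow> y \<in> I \<Longrightarrow> x - y \<in> I"
  using ideal_add[of I x "-1 * y"] ideal_mult_left[of I y "-1"] by simp

lemma ideal_sum: "ideal I O_Y \<Longrightarrow> (\<And>x. x \<in> A \<Longrightarrow> f x \<in> I) \<Longrightarrow> sum f A \<in> I"
  by (induction A rule: infinite_finite_induct) (auto intro: ideal_zero ideal_add)

lemma coset_eq_iff:
  assumes "ideal I O_Y"
  shows "I +>\<^bsub>O_Y\<^esub> f = I +>\<^bsub>O_Y\<^esub> g \<longleftrightarrow> f - g \<in> I"
proof -
  have coset: "I +>\<^bsub>O_Y\<^esub> h = {x. x - h \<in> I}" for h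
    by (auto simp: a_r_coset_def r_coset_def ring_of_type_algebra_def
        intro!: bexI[of _ "_ - h"])
  have *: "x - f \<in> I \<longleftrightarrow> x - g \<in> I" if "f - g \<in> I" for x
    using ideal_add[OF assms _ that, of "x - f"] ideal_diff[OF assms _ that, of "x - g"]
    by auto
  show ?thesis
    unfolding coset using * ideal_zero[OF assms] by (auto simp: set_eq_iff)
qed

lemma cring_Quot: "ideal I O_Y \<Longrightarrow> cring (O_Y Quot I)"
  by (rule ideal.quotient_is_cring) (auto intro: cring_from_type_algebra)

lemma Quot_ops:
  assumes "ideal I O_Y"
  shows "carrier (O_Y Quot I) = range (\<lambda>f. I +>\<^bsub>O_Y\<^esub> f)"
    and "(I +>\<^bsub>O_Y\<^esub> f) \<otimes>\<^bsub>O_Y Quot I\<^esub> (I +>\<^bsub>O_Y\<^esub> g) = I +>\<^bsub>O_Y\<^esub> (f * g)"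
    and "\<zero>\<^bsub>O_Y Quot I\<^esub> = I +>\<^bsub>O_Y\<^esub> 0" and "\<one>\<^bsub>O_Y Quot I\<^esub> = I +>\<^bsub>O_Y\<^esub> 1"
proof -
  interpret ideal I O_Y by fact
  have ops: "monoid.mult O_Y = (*)" "carrier O_Y = UNIV" "\<zero>\<^bsub>O_Y\<^esub> = 0" "\<one>\<^bsub>O_Y\<^esub> = 1"
    by (simp_all add: ring_of_type_algebra_def)
  show "carrier (O_Y Quot I) = range (\<lambda>f. I +>\<^bsub>O_Y\<^esub> f)"
    by (auto simp: FactRing_def A_RCOSETS_def' a_r_coset_def' ops)
  show "(I +>\<^bsub>O_Y\<^esub> f) \<otimes>\<^bsub>O_Y Quot I\<^esub> (I +>\<^bsub>O_Y\<^esub> g) = I +>\<^bsub>O_Y\<^esub> (f * g)"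
    using rcoset_mult_add[of f g] by (simp add: FactRing_def ops)
  show "\<one>\<^bsub>O_Y Quot I\<^esub> = I +>\<^bsub>O_Y\<^esub> 1"
    by (simp add: FactRing_def ops)
  show "\<zero>\<^bsub>O_Y Quot I\<^esub> = I +>\<^bsub>O_Y\<^esub> 0"
    by (simp add: FactRing_def a_r_coset_def r_coset_def ring_of_type_algebra_def)
qed

lemma nonzerodivisor_Quot_iff:
  assumes "ideal I O_Y"
  shows "I +>\<^bsub>O_Y\<^esub> s \<in> nonzerodivisors (O_Y Quot I) \<longleftrightarrow> (\<forall>f. f * s \<in> I \<longrightarrow> f \<in> I)"
  by (auto simp: nonzerodivisors_def Quot_ops[OF assms] coset_eq_iff[OF assms])

lemma fraction_Quot_eq_iff:
  assumes "ideal I O_Y" "I +>\<^bsub>O_Y\<^esub> s \<in> nonzerodivisors (O_Y Quot I)"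
    "I +>\<^bsub>O_Y\<^esub> t \<in> nonzerodivisors (O_Y Quot I)"
  shows "fraction (O_Y Quot I) (I +>\<^bsub>O_Y\<^esub> a) (I +>\<^bsub>O_Y\<^esub> s) =
      fraction (O_Y Quot I) (I +>\<^bsub>O_Y\<^esub> b) (I +>\<^bsub>O_Y\<^esub> t) \<longleftrightarrow> a * t - b * s \<in> I"
  by (subst cring.fraction_eq_iff[OF cring_Quot[OF assms(1)] assms(2,3)])
     (auto simp: Quot_ops[OF assms(1)] coset_eq_iff[OF assms(1)])


section \<open>Ideals of germs\<close>

lemma ideal_germ_ideal: "ideal (germ_ideal Z) O_Y"
  unfolding ideal_O_Y_iff
proof (intro conjI ballI allI)
  show "0 \<in> germ_ideal Z"
    by (simp add: germ_ideal_def series_eval_def zero_conv_series.rep_eq)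
  show "f + g \<in> germ_ideal Z" if "f \<in> germ_ideal Z" "g \<in> germ_ideal Z" for f g
    using that[unfolded germ_ideal_def mem_Collect_eq] series_eval_add_nhds[of f g]
    unfolding germ_ideal_def mem_Collect_eq by eventually_elim simp
  show "r * f \<in> germ_ideal Z" if "f \<in> germ_ideal Z" for f r
    using that[unfolded germ_ideal_def mem_Collect_eq] series_eval_mult_nhds[of r f]
    unfolding germ_ideal_def mem_Collect_eq by eventually_elim simp
qed

lemma germ_ideal_radical:
  assumes "f * f \<in> germ_ideal Z"
  shows "f \<in> germ_ideal Z"
  using assms[unfolded germ_ideal_def mem_Collect_eq] series_eval_mult_nhds[of f f]
  unfolding germ_ideal_def mem_Collect_eq by eventually_elim simp

lemma germ_ideal_antimono: "germ_subset V C \<Longrightarrow> germ_ideal C \<subseteq> germ_ideal V"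
  unfolding germ_ideal_def germ_subset_def by (auto elim: eventually_elim2)

lemma germ_ideal_mult_complement:
  assumes "f \<in> germ_ideal V" "g \<in> germ_ideal (closure (C - V))"
  shows "f * g \<in> germ_ideal C"
  using assms[unfolded germ_ideal_def mem_Collect_eq] series_eval_mult_nhds[of f g]
  unfolding germ_ideal_def mem_Collect_eq
proof eventually_elim
  case (elim z)
  then show ?case using closure_subset[of "C - V"] by auto
qed


section \<open>Congruences satisfied by a fundamental form\<close>

text \<open>
  The defining equations of the fundamental form, with denominators cleared. With \<open>(1, 0) = a / s\<close>
  adapted to \<open>V\<close> and \<open>(1, 0) = b / t\<close> adapted to \<open>V' = closure (C - V)\<close>, they read
  \<open>s \<alpha> \<equiv> a dh\<close>, \<open>t \<alpha> \<equiv> b dh\<close> and \<open>a t \<equiv> b s\<close> modulo the ideal of \<open>C\<close>. Cancelling \<open>s\<close>, which agrees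
  with \<open>a\<close> on \<open>V\<close>, gives the statements about the ideal of \<open>V\<close>; multiplying by a series vanishing
  on \<open>V\<close>, whose product with \<open>b\<close> vanishes on all of \<open>C\<close>, and cancelling \<open>t\<close> gives those about the
  ideal of \<open>C\<close>.
\<close>

lemma fundamental_form_congruences:
  fixes V C :: "(complex ^ 'n::{finite,linorder}) set"
  assumes "fundamental_form C hs V \<alpha>" "germ_subset V C"
  obtains a where "\<And>f. f * a \<in> germ_ideal V \<Longrightarrow> f \<in> germ_ideal V"
    "\<And>f. f \<in> germ_ideal V \<Longrightarrow> a * f \<in> germ_ideal C"
    "\<And>J. \<alpha> J - wedge_differentials hs J \<in> germ_ideal V"
    "\<And>J f. f \<in> germ_ideal V \<Longrightarrow> \<alpha> J * f \<in> germ_ideal C"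
proof -
  let ?W = "closure (C - V)" and ?h = "wedge_differentials hs"
  note CV = subsetD[OF germ_ideal_antimono[OF assms(2)]]
  note idl = ideal_germ_ideal
  obtain e where e: "is_indicator C V e"
    "\<And>J. to_total_fractions C (\<alpha> J) =
       e \<otimes>\<^bsub>total_fractions_of C\<^esub> to_total_fractions C (?h J)"
    using assms(1) unfolding fundamental_form_def by blast
  have one: "\<one>\<^bsub>total_fractions_of Z\<^esub> =
      fraction (structure_ring Z) (germ_res Z 1) (germ_res Z 1)" for Z :: "(complex ^ 'n::{finite,linorder}) set"
    by (simp add: total_fractions_def Quot_ops[OF idl])
  have zero: "\<zero>\<^bsub>total_fractions_of Z\<^esub> =
      fraction (structure_ring Z) (germ_res Z 0) (germ_res Z 1)" for Z :: "(complex ^ 'n::{finite,linorder}) set"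
    by (simp add: total_fractions_def Quot_ops[OF idl])
  have nz1: "germ_res Z 1 \<in> nonzerodivisors (structure_ring Z)" for Z :: "(complex ^ 'n::{finite,linorder}) set"
    by (simp add: nonzerodivisor_Quot_iff[OF idl])
  obtain a s where s: "germ_res C s \<in> nonzerodivisors (structure_ring C)"
      "germ_res V s \<in> nonzerodivisors (structure_ring V)"
    and ea: "e = fraction (structure_ring C) (germ_res C a) (germ_res C s)"
    and av: "\<one>\<^bsub>total_fractions_of V\<^esub> =
      fraction (structure_ring V) (germ_res V a) (germ_res V s)"
    using e(1) unfolding is_indicator_def fraction_restricts_to_def by blast
  obtain b t where t: "germ_res C t \<in> nonzerodivisors (structure_ring C)"
      "germ_res ?W t \<in> nonzerodivisors (structure_ring ?W)"
    and eb: "e = fraction (structure_ring C) (germ_res C b) (germ_res C t)"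
    and bw: "\<zero>\<^bsub>total_fractions_of ?W\<^esub> =
      fraction (structure_ring ?W) (germ_res ?W b) (germ_res ?W t)"
    using e(1) unfolding is_indicator_def fraction_restricts_to_def by blast
  have sa: "s - a \<in> germ_ideal V"
    using av unfolding one by (simp add: fraction_Quot_eq_iff[OF idl nz1 s(2)])
  have "0 - b \<in> germ_ideal ?W"
    using bw unfolding zero by (simp add: fraction_Quot_eq_iff[OF idl nz1 t(2)])
  then have b: "b \<in> germ_ideal ?W"
    using ideal_mult_left[OF idl, of "- b" ?W "-1"] by simp
  have ab: "a * t - b * s \<in> germ_ideal C"
    using ea eb fraction_Quot_eq_iff[OF idl s(1) t(1), of a b] by metis
  have coord: "\<alpha> J * u - c * ?h J \<in> germ_ideal C"
    if u: "germ_res C u \<in> nonzerodivisors (structure_ring C)"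
      and "e = fraction (structure_ring C) (germ_res C c) (germ_res C u)" for J c u
  proof -
    have "fraction (structure_ring C) (germ_res C (\<alpha> J)) (germ_res C 1) =
        fraction (structure_ring C) (germ_res C (c * ?h J)) (germ_res C (u * 1))"
      using e(2)[of J] u nz1[of C] that(2)
      by (simp add: to_total_fractions_def Quot_ops[OF idl]
          cring.total_fractions_mult[OF cring_Quot[OF idl]] del: mult_1_right)
    then show ?thesis
      using u by (simp add: fraction_Quot_eq_iff[OF idl nz1])
  qed
  have s': "f \<in> germ_ideal V" if "f * s \<in> germ_ideal V" for f
    using that s(2) nonzerodivisor_Quot_iff[OF idl] by blast
  have t': "f \<in> germ_ideal C" if "f * t \<in> germ_ideal C" for f
    using that t(1) nonzerodivisor_Quot_iff[OF idl] by blast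
  have fb: "f * b \<in> germ_ideal C" if "f \<in> germ_ideal V" for f
    using germ_ideal_mult_complement[OF that b] .
  show ?thesis
  proof (rule that[of a])
    show "f \<in> germ_ideal V" if "f * a \<in> germ_ideal V" for f
    proof (rule s')
      have "f * s = f * a + f * (s - a)" by (simp add: algebra_simps)
      then show "f * s \<in> germ_ideal V"
        using that sa by (auto intro: ideal_add[OF idl] ideal_mult_left[OF idl])
    qed
    show "a * f \<in> germ_ideal C" if "f \<in> germ_ideal V" for f
    proof (rule t')
      have "a * f * t = (a * t - b * s) * f + f * b * s" by (simp add: algebra_simps)
      then show "a * f * t \<in> germ_ideal C"
        using ab fb[OF that] by (auto intro: ideal_add[OF idl] ideal_mult_right[OF idl])
    qed
    show "\<alpha> J - ?h J \<in> germ_ideal V" for J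
    proof (rule s')
      have "(\<alpha> J - ?h J) * s = (\<alpha> J * s - a * ?h J) - (s - a) * ?h J"
        by (simp add: algebra_simps)
      then show "(\<alpha> J - ?h J) * s \<in> germ_ideal V"
        using CV[OF coord[OF s(1) ea, of J]] sa
        by (auto intro: ideal_diff[OF idl] ideal_mult_right[OF idl])
    qed
    show "\<alpha> J * f \<in> germ_ideal C" if "f \<in> germ_ideal V" for f J
    proof (rule t')
      have "\<alpha> J * f * t = (\<alpha> J * t - b * ?h J) * f + f * b * ?h J"
        by (simp add: algebra_simps)
      then show "\<alpha> J * f * t \<in> germ_ideal C"
        using coord[OF t(1) eb, of J] fb[OF that]
        by (auto intro: ideal_add[OF idl] ideal_mult_right[OF idl])
    qed
  qed
qed


section \<open>Wedge products of one-forms\<close>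

text \<open>
  The power \<open>(-1) ^ card {l \<in> K. l < i}\<close> is the sign of moving \<open>dx\<^sub>i\<close> to the front of \<open>dx\<^sub>K\<close>.
  Extracting two factors in either order changes the count only for the larger of the two indices:
  the smaller one precedes it in \<open>K\<close>, but no longer once it has been removed.
\<close>

lemma insertion_sign_commute:
  fixes i j :: "'n::{finite,linorder}"
  assumes "i \<in> K" "j \<in> K" "i \<noteq> j"
  shows "(-1) ^ card {l\<in>K. l < i} * (-1) ^ card {l\<in>K - {i}. l < j} =
     - ((-1) ^ card {l\<in>K. l < j} * (-1) ^ card {l\<in>K - {j}. l < i} :: 'a::comm_ring_1)"
proof -
  have *: "(-1) ^ card {l\<in>K. l < i} * (-1) ^ card {l\<in>K - {i}. l < j} =
     - ((-1) ^ card {l\<in>K. l < j} * (-1) ^ card {l\<in>K - {j}. l < i} :: 'a)"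
    if "i < j" "i \<in> K" for i j :: 'n
  proof -
    have "{l\<in>K - {j}. l < i} = {l\<in>K. l < i}" using that by auto
    moreover have "{l\<in>K. l < j} = insert i {l\<in>K - {i}. l < j}" using that by auto
    ultimately show ?thesis by simp
  qed
  show ?thesis
    using *[of i j] *[of j i] assms by (cases i j rule: linorder_cases) auto
qed

lemma wedge_one_form:
  assumes "\<eta> \<in> Omega 1"
  shows "wedge \<eta> \<omega> K = (\<Sum>i\<in>K. (-1) ^ card {l\<in>K. l < i} * \<eta> {i} * \<omega> (K - {i}))"
proof -
  have sgn: "shuffle_sign {i} (K - {i}) = (-1) ^ card {l\<in>K. l < i}" for i
  proof -
    have "{(i', j). i' \<in> {i} \<and> j \<in> K - {i} \<and> j < i'} = Pair i ` {l\<in>K. l < i}" by auto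
    then show ?thesis by (simp add: shuffle_sign_def card_image inj_on_def)
  qed
  have "wedge \<eta> \<omega> K =
      (\<Sum>I\<in>(\<lambda>i. {i}) ` K. shuffle_sign I (K - I) * \<eta> I * \<omega> (K - I))"
    unfolding wedge_def
  proof (rule sum.mono_neutral_right)
    show "\<forall>I\<in>Pow K - (\<lambda>i. {i}) ` K. shuffle_sign I (K - I) * \<eta> I * \<omega> (K - I) = 0"
    proof
      fix I assume I: "I \<in> Pow K - (\<lambda>i. {i}) ` K"
      then have "card I \<noteq> 1" by (auto simp: card_1_singleton_iff)
      then show "shuffle_sign I (K - I) * \<eta> I * \<omega> (K - I) = 0"
        using assms by (simp add: Omega_def)
    qed
  qed auto
  also have "\<dots> = (\<Sum>i\<in>K. (-1) ^ card {l\<in>K. l < i} * \<eta> {i} * \<omega> (K - {i}))"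
    by (subst sum.reindex) (auto simp: inj_on_def sgn)
  finally show ?thesis .
qed

lemma wedge_one_forms_anticommute:
  assumes "\<eta> \<in> Omega 1" "\<theta> \<in> Omega 1"
  shows "wedge \<eta> (wedge \<theta> \<omega>) = (\<lambda>K. - wedge \<theta> (wedge \<eta> \<omega>) K)"
proof
  fix K
  define F where "F \<eta> \<theta> i j = (if i = j then 0 else
     (-1) ^ card {l\<in>K. l < i} * (-1) ^ card {l\<in>K - {i}. l < j} *
       (\<eta> {i} * \<theta> {j} * \<omega> (K - {i} - {j})))" for \<eta> \<theta> :: "'a form" and i j
  have expand: "wedge \<eta> (wedge \<theta> \<omega>) K = (\<Sum>i\<in>K. \<Sum>j\<in>K. F \<eta> \<theta> i j)"
    if "\<eta> \<in> Omega 1" "\<theta> \<in> Omega 1" for \<eta> \<theta>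
    unfolding wedge_one_form[OF that(1)] wedge_one_form[OF that(2)] sum_distrib_left
    by (intro sum.cong sum.mono_neutral_cong_left) (auto simp: F_def)
  have "F \<eta> \<theta> i j = - F \<theta> \<eta> j i" if "i \<in> K" "j \<in> K" for i j
  proof -
    have "K - {i} - {j} = K - {j} - {i}" by auto
    then show ?thesis
      using that insertion_sign_commute[of i K j, where ?'a = "'a conv_series"]
      by (cases "i = j") (simp_all add: F_def mult.commute)
  qed
  then have "(\<Sum>i\<in>K. \<Sum>j\<in>K. F \<eta> \<theta> i j) = (\<Sum>i\<in>K. \<Sum>j\<in>K. - F \<theta> \<eta> j i)"
    by simp
  also have "\<dots> = - (\<Sum>j\<in>K. \<Sum>i\<in>K. F \<theta> \<eta> j i)"
    by (subst sum.swap) (simp add: sum_negf)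
  finally show "wedge \<eta> (wedge \<theta> \<omega>) K = - wedge \<theta> (wedge \<eta> \<omega>) K"
    using assms by (simp add: expand)
qed

lemma conv_series_eq_uminus_self: "f = - f \<Longrightarrow> f = (0 :: 'n::finite conv_series)"
  by transfer (auto simp: fun_eq_iff equal_neg_zero)

lemma wedge_one_form_square:
  assumes "\<eta> \<in> Omega 1"
  shows "wedge \<eta> (wedge \<eta> \<omega>) = (\<lambda>_. 0)"
  using wedge_one_forms_anticommute[OF assms assms, of \<omega>]
  by (metis conv_series_eq_uminus_self)

definition wedge_list :: "'n::{finite,linorder} form list \<Rightarrow> 'n form" where
  "wedge_list \<theta>s = foldr wedge \<theta>s (\<lambda>J. if J = {} then 1 else 0)"

lemma wedge_list_simps [simp]:
  "wedge_list [] = (\<lambda>J. if J = {} then 1 else 0)"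
  "wedge_list (\<theta> # \<theta>s) = wedge \<theta> (wedge_list \<theta>s)"
  by (simp_all add: wedge_list_def)

lemma wedge_list_singleton: "wedge_list [\<theta>] = \<theta>"
proof
  fix K
  have "wedge \<theta> (\<lambda>J. if J = {} then 1 else 0) K = (\<Sum>I\<in>{K}. \<theta> I)"
    unfolding wedge_def
    by (rule sum.mono_neutral_cong_right) (auto simp: shuffle_sign_def)
  then show "wedge_list [\<theta>] K = \<theta> K" by simp
qed

lemma wedge_scale_left: "wedge (\<lambda>J. c * \<omega> J) \<eta> = (\<lambda>J. c * wedge \<omega> \<eta> J)"
  by (simp add: wedge_def sum_distrib_left mult_ac)

lemma wedge_scale_right: "wedge \<omega> (\<lambda>J. c * \<eta> J) = (\<lambda>J. c * wedge \<omega> \<eta> J)"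
  by (simp add: wedge_def sum_distrib_left mult_ac)

lemma wedge_add_left: "wedge (\<lambda>J. \<omega> J + \<omega>' J) \<eta> = (\<lambda>J. wedge \<omega> \<eta> J + wedge \<omega>' \<eta> J)"
  by (simp add: wedge_def sum.distrib algebra_simps)

lemma wedge_add_right: "wedge \<omega> (\<lambda>J. \<eta> J + \<eta>' J) = (\<lambda>J. wedge \<omega> \<eta> J + wedge \<omega> \<eta>' J)"
  by (simp add: wedge_def sum.distrib algebra_simps)

text \<open>
  Each transposition costs a sign. The factor \<open>c\<close> is left unspecified, since only proportionality
  matters for rearranged products.
\<close>

lemma wedge_list_move_to_front:
  assumes "set xs \<subseteq> Omega 1" "y \<in> Omega 1"
  shows "\<exists>c. wedge_list (xs @ y # zs) = (\<lambda>J. c * wedge_list (y # xs @ zs) J)"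
  using assms(1)
proof (induction xs)
  case Nil
  show ?case by (intro exI[of _ 1]) simp
next
  case (Cons x xs)
  then obtain c where "wedge_list (xs @ y # zs) = (\<lambda>J. c * wedge_list (y # xs @ zs) J)" by auto
  then have "wedge_list ((x # xs) @ y # zs) = (\<lambda>J. - c * wedge_list (y # (x # xs) @ zs) J)"
    using Cons.prems assms(2)
    by (simp add: wedge_scale_right wedge_one_forms_anticommute[of x y])
  then show ?case by blast
qed

lemma wedge_list_mset_eq:
  assumes "set xs \<subseteq> Omega 1" "mset xs = mset ys"
  shows "\<exists>c. wedge_list xs = (\<lambda>J. c * wedge_list ys J)"
  using assms
proof (induction ys arbitrary: xs)
  case Nil
  then show ?case by (auto intro: exI[of _ 1])
next
  case (Cons y ys)
  from Cons.prems(2) obtain us vs where xs: "xs = us @ y # vs"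
    by (metis list.set_intros(1) mset_eq_setD split_list)
  with Cons.prems have m: "mset (us @ vs) = mset ys" by simp
  obtain c where c: "wedge_list xs = (\<lambda>J. c * wedge_list (y # us @ vs) J)"
    using wedge_list_move_to_front[of us y vs] Cons.prems(1) xs by auto
  obtain d where "wedge_list (us @ vs) = (\<lambda>J. d * wedge_list ys J)"
    using Cons.IH[OF _ m] Cons.prems(1) xs by auto
  with c have "wedge_list xs = (\<lambda>J. c * d * wedge_list (y # ys) J)"
    by (simp add: wedge_scale_right mult.assoc)
  then show ?case by blast
qed

lemma wedge_list_not_distinct:
  assumes "set xs \<subseteq> Omega 1" "\<not> distinct xs"
  shows "wedge_list xs = (\<lambda>_. 0)"
proof -
  obtain us vs ws y where xs: "xs = us @ [y] @ vs @ [y] @ ws"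
    using not_distinct_decomp[OF assms(2)] by blast
  then have "mset xs = mset (y # y # us @ vs @ ws)" by simp
  with assms(1) obtain c where
    "wedge_list xs = (\<lambda>J. c * wedge_list (y # y # us @ vs @ ws) J)"
    using wedge_list_mset_eq by blast
  then show ?thesis
    using assms(1) xs by (simp add: wedge_one_form_square)
qed


section \<open>Spans of wedge products modulo an ideal\<close>

text \<open>
  The forms that are congruent modulo \<open>I\<close>, coordinate by coordinate, to a linear combination of
  \<open>m\<close>-fold wedge products of elements of \<open>\<Theta>\<close>. The inductive description keeps multilinear
  expansions out of the proofs: bilinearity of the wedge product becomes rule induction.
\<close>

inductive_set wedge_span ::
    "'n::{finite,linorder} conv_series set \<Rightarrow> 'n form set \<Rightarrow> nat \<Rightarrow> 'n form set"
  for I \<Theta> m where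
    congruent_zero: "(\<And>J. \<omega> J \<in> I) \<Longrightarrow> \<omega> \<in> wedge_span I \<Theta> m"
  | wedge: "set \<theta>s \<subseteq> \<Theta> \<Longrightarrow> length \<theta>s = m \<Longrightarrow> (\<lambda>J. c * wedge_list \<theta>s J) \<in> wedge_span I \<Theta> m"
  | add: "\<omega> \<in> wedge_span I \<Theta> m \<Longrightarrow> \<eta> \<in> wedge_span I \<Theta> m \<Longrightarrow>
      (\<lambda>J. \<omega> J + \<eta> J) \<in> wedge_span I \<Theta> m"

lemma wedge_span_scale:
  assumes "ideal I O_Y" "\<omega> \<in> wedge_span I \<Theta> m"
  shows "(\<lambda>J. c * \<omega> J) \<in> wedge_span I \<Theta> m"
  using assms(2)
proof induction
  case (congruent_zero \<omega>)
  then show ?case by (intro wedge_span.congruent_zero ideal_mult_left[OF assms(1)])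
next
  case (wedge \<theta>s d)
  then show ?case using wedge_span.wedge[of \<theta>s \<Theta> m "c * d"] by (simp add: mult.assoc)
next
  case (add \<omega> \<eta>)
  then show ?case using wedge_span.add by (fastforce simp: distrib_left)
qed

lemma wedge_congruent_zero_left:
  assumes "ideal I O_Y" "\<And>J. \<omega> J \<in> I"
  shows "wedge \<omega> \<eta> J \<in> I"
  unfolding wedge_def
  by (intro ideal_sum[OF assms(1)] ideal_mult_right[OF assms(1)] ideal_mult_left[OF assms(1)] assms(2))

lemma wedge_congruent_zero_right:
  assumes "ideal I O_Y" "\<And>J. \<eta> J \<in> I"
  shows "wedge \<omega> \<eta> J \<in> I"
  unfolding wedge_def
  by (intro ideal_sum[OF assms(1)] ideal_mult_left[OF assms(1)] assms(2))

lemma wedge_wedge_span: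
  assumes "ideal I O_Y" "\<eta> \<in> wedge_span I \<Theta> 1" "\<omega> \<in> wedge_span I \<Theta> m"
  shows "wedge \<eta> \<omega> \<in> wedge_span I \<Theta> (Suc m)"
  using assms(2)
proof induction
  case (congruent_zero \<eta>)
  then show ?case
    by (intro wedge_span.congruent_zero wedge_congruent_zero_left[OF assms(1)])
next
  case (wedge \<theta>s c)
  then obtain \<theta> where \<theta>: "\<theta> \<in> \<Theta>" "wedge_list \<theta>s = \<theta>"
    by (auto simp: length_Suc_conv wedge_list_singleton simp del: wedge_list_simps(2))
  have "wedge \<theta> \<omega> \<in> wedge_span I \<Theta> (Suc m)"
    using assms(3)
  proof induction
    case (congruent_zero \<omega>)
    then show ?case
      by (intro wedge_span.congruent_zero wedge_congruent_zero_right[OF assms(1)])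
  next
    case (wedge \<theta>s c)
    then show ?case
      using wedge_span.wedge[of "\<theta> # \<theta>s" \<Theta> "Suc m" c] \<theta>(1) by (simp add: wedge_scale_right)
  next
    case (add \<omega> \<omega>')
    then show ?case by (simp add: wedge_add_right wedge_span.add)
  qed
  then show ?case
    by (simp add: \<theta>(2) wedge_scale_left wedge_span_scale[OF assms(1)])
next
  case (add \<eta> \<eta>')
  then show ?case by (simp add: wedge_add_left wedge_span.add)
qed

text \<open>
  This replaces the determinant. A product of as many one-forms as there are generators \<open>\<theta>s\<close>, all
  chosen among them, either repeats a factor and vanishes, or is a rearrangement of the product of
  \<open>\<theta>s\<close>.
\<close>

lemma wedge_span_top_degree:
  assumes "ideal I O_Y" "set \<theta>s \<subseteq> Omega 1" "\<omega> \<in> wedge_span I (set \<theta>s) (length \<theta>s)"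
  shows "\<exists>c. \<forall>J. \<omega> J - c * wedge_list \<theta>s J \<in> I"
  using assms(3)
proof induction
  case (congruent_zero \<omega>)
  then show ?case by (intro exI[of _ 0]) simp
next
  case (wedge \<tau>s d)
  show ?case
  proof (cases "distinct \<tau>s")
    case True
    have "card (set \<tau>s) = length \<theta>s"
      using True wedge by (simp add: distinct_card)
    moreover from this have "set \<tau>s = set \<theta>s"
      using wedge(1) card_length[of \<theta>s] by (intro card_seteq) auto
    ultimately have "set \<tau>s = set \<theta>s" "distinct \<theta>s"
      by (auto intro: card_distinct)
    then have "mset \<tau>s = mset \<theta>s"
      using True by (simp add: set_eq_iff_mset_eq_distinct)
    then obtain c where "wedge_list \<tau>s = (\<lambda>J. c * wedge_list \<theta>s J)"
      using wedge_list_mset_eq[of \<tau>s \<theta>s] wedge(1) assms(2) by blast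
    then show ?thesis
      by (intro exI[of _ "d * c"]) (simp add: mult.assoc ideal_zero[OF assms(1)])
  next
    case False
    then have "wedge_list \<tau>s = (\<lambda>_. 0)"
      using wedge_list_not_distinct wedge(1) assms(2) by blast
    then show ?thesis
      by (intro exI[of _ 0]) (simp add: ideal_zero[OF assms(1)])
  qed
next
  case (add \<omega> \<eta>)
  then obtain c d where "\<forall>J. \<omega> J - c * wedge_list \<theta>s J \<in> I" "\<forall>J. \<eta> J - d * wedge_list \<theta>s J \<in> I"
    by blast
  then have "\<forall>J. (\<omega> J - c * wedge_list \<theta>s J) + (\<eta> J - d * wedge_list \<theta>s J) \<in> I"
    using ideal_add[OF assms(1)] by blast
  then show ?case
    by (intro exI[of _ "c + d"]) (simp add: algebra_simps)
qed


section \<open>Differentials of elements of an ideal\<close>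

lemma differential_add: "differential (f + g) J = differential f J + differential g J"
  by (auto simp: differential_def partial_deriv_add sum.distrib[symmetric] intro!: sum.cong)

lemma differential_mult: "differential (f * g) J = f * differential g J + g * differential f J"
  by (auto simp: differential_def partial_deriv_mult sum_distrib_left sum.distrib[symmetric]
      algebra_simps intro!: sum.cong)

lemma differential_Omega: "differential f \<in> Omega 1"
  by (auto simp: Omega_def differential_def intro!: sum.neutral)

lemma wedge_differentials_eq_wedge_list:
  "wedge_differentials fs = wedge_list (map differential fs)"
  by (simp add: wedge_differentials_def wedge_list_def foldr_map o_def)

text \<open>
  Differentiating \<open>g = \<Sum>\<^sub>j c\<^sub>j h\<^sub>j\<close> gives \<open>\<Sum>\<^sub>j c\<^sub>j dh\<^sub>j + \<Sum>\<^sub>j h\<^sub>j dc\<^sub>j\<close>, and the second sum vanishes modulo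
  \<open>I\<close>. In the proof, the Leibniz rule shows that the elements of \<open>I\<close> whose differential has the
  required form are an ideal, so that no coefficients \<open>c\<^sub>j\<close> have to be chosen.
\<close>

lemma differential_of_generated:
  assumes "ideal I O_Y" "set hs \<subseteq> I" "g \<in> Idl\<^bsub>O_Y\<^esub> (set hs)"
  shows "differential g \<in> wedge_span I (differential ` set hs) 1"
proof -
  let ?S = "wedge_span I (differential ` set hs) 1"
  interpret O: cring O_Y by (rule cring_from_type_algebra)
  have zero: "differential 0 J = 0" for J :: "'a set"
    using differential_add[of 0 0 J] by simp
  have "ideal {g \<in> I. differential g \<in> ?S} O_Y"
    unfolding ideal_O_Y_iff
  proof (intro conjI ballI allI)
    show "0 \<in> {g \<in> I. differential g \<in> ?S}"
      by (auto intro!: wedge_span.congruent_zero simp: zero ideal_zero[OF assms(1)])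
    show "f + g \<in> {g \<in> I. differential g \<in> ?S}"
      if "f \<in> {g \<in> I. differential g \<in> ?S}" "g \<in> {g \<in> I. differential g \<in> ?S}" for f g
    proof -
      have "differential (f + g) = (\<lambda>J. differential f J + differential g J)"
        by (simp add: fun_eq_iff differential_add)
      then show ?thesis
        using that by (auto intro: wedge_span.add ideal_add[OF assms(1)])
    qed
    show "r * f \<in> {g \<in> I. differential g \<in> ?S}" if "f \<in> {g \<in> I. differential g \<in> ?S}" for f r
    proof -
      have "differential (r * f) = (\<lambda>J. r * differential f J + f * differential r J)"
        by (simp add: fun_eq_iff differential_mult)
      moreover have "(\<lambda>J. f * differential r J) \<in> ?S"
        using that by (auto intro: wedge_span.congruent_zero ideal_mult_right[OF assms(1)])
      ultimately show ?thesis
        using that wedge_span_scale[OF assms(1)]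
        by (auto intro: wedge_span.add ideal_mult_left[OF assms(1)])
    qed
  qed
  moreover have "set hs \<subseteq> {g \<in> I. differential g \<in> ?S}"
  proof
    fix h assume h: "h \<in> set hs"
    then have "(\<lambda>J. 1 * wedge_list [differential h] J) \<in> ?S"
      by (intro wedge_span.wedge) auto
    then show "h \<in> {g \<in> I. differential g \<in> ?S}"
      using h assms(2) by (auto simp: wedge_list_singleton simp del: wedge_list_simps)
  qed
  ultimately have "Idl\<^bsub>O_Y\<^esub> (set hs) \<subseteq> {g \<in> I. differential g \<in> ?S}"
    by (rule O.genideal_minimal)
  then show ?thesis using assms(3) by blast
qed

text \<open>
  If \<open>a\<close> multiplies \<open>I\<close> into the ideal generated by \<open>h\<^sub>1, \<dots>, h\<^sub>k\<close>, then \<open>a df = d(a f) - f da\<close> is, modulo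
  \<open>I\<close>, a combination of the \<open>dh\<^sub>j\<close> for every \<open>f \<in> I\<close>: up to the factor \<open>a\<close>,
  the zero set of \<open>I\<close> has no more conormal directions than that of the \<open>h\<^sub>j\<close>.
\<close>

lemma wedge_differentials_proportional:
  assumes "ideal I O_Y" "set hs \<subseteq> I"
    and "\<And>f. f \<in> I \<Longrightarrow> a * f \<in> Idl\<^bsub>O_Y\<^esub> (set hs)"
    and "set fs \<subseteq> I" "length fs = length hs"
  shows "\<exists>c. \<forall>J. a ^ length fs * wedge_differentials fs J - c * wedge_differentials hs J \<in> I"
proof -
  let ?\<Theta> = "set (map differential hs)"
  have one: "(\<lambda>J. a * differential f J) \<in> wedge_span I ?\<Theta> 1" if "f \<in> I" for f
  proof -
    have eq: "(\<lambda>J. a * differential f J) = (\<lambda>J. differential (a * f) J + f * - differential a J)"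
      by (simp add: fun_eq_iff differential_mult)
    have "(\<lambda>J. f * - differential a J) \<in> wedge_span I ?\<Theta> 1"
      using that by (intro wedge_span.congruent_zero ideal_mult_right[OF assms(1)])
    then show ?thesis
      unfolding eq using differential_of_generated[OF assms(1,2) assms(3)[OF that]]
      by (intro wedge_span.add) simp_all
  qed
  have "(\<lambda>J. a ^ length fs * wedge_list (map differential fs) J) \<in> wedge_span I ?\<Theta> (length fs)"
    using assms(4)
  proof (induction fs)
    case Nil
    show ?case using wedge_span.wedge[of "[]" ?\<Theta> 0 1 I] by simp
  next
    case (Cons f fs)
    have "wedge (\<lambda>J. a * differential f J) (\<lambda>J. a ^ length fs * wedge_list (map differential fs) J)
        \<in> wedge_span I ?\<Theta> (Suc (length fs))"
      using Cons one by (intro wedge_wedge_span[OF assms(1)]) auto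
    then show ?case by (simp add: wedge_scale_left wedge_scale_right mult_ac)
  qed
  then show ?thesis
    using wedge_span_top_degree[OF assms(1), of "map differential hs"] assms(5) differential_Omega
    by (fastforce simp: wedge_differentials_eq_wedge_list)
qed


section \<open>Logarithmic multivector fields\<close>

lemma pairing_wedge_congruent_zero:
  assumes "ideal I O_Y" "\<And>J. \<omega> J \<in> I"
  shows "pairing \<delta> (wedge \<omega> \<xi>) \<in> I"
  unfolding pairing_def
  by (intro ideal_sum[OF assms(1)] ideal_mult_left[OF assms(1)]
      wedge_congruent_zero_left[OF assms(1)] assms(2))

lemma pairing_wedge_scale: "pairing \<delta> (wedge (\<lambda>J. c * \<omega> J) \<xi>) = c * pairing \<delta> (wedge \<omega> \<xi>)"
  by (simp add: pairing_def wedge_scale_left sum_distrib_left mult_ac)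

lemma pairing_wedge_diff:
  "pairing \<delta> (wedge (\<lambda>J. \<omega> J - \<eta> J) \<xi>) = pairing \<delta> (wedge \<omega> \<xi>) - pairing \<delta> (wedge \<eta> \<xi>)"
  by (simp add: pairing_def wedge_def sum_subtractf algebra_simps)

lemma pairing_wedge_cong:
  assumes "ideal I O_Y" "\<And>J. \<omega> J - \<eta> J \<in> I"
  shows "pairing \<delta> (wedge \<omega> \<xi>) \<in> I \<longleftrightarrow> pairing \<delta> (wedge \<eta> \<xi>) \<in> I"
proof -
  have *: "pairing \<delta> (wedge \<omega> \<xi>) - pairing \<delta> (wedge \<eta> \<xi>) \<in> I"
    using pairing_wedge_congruent_zero[OF assms] by (simp add: pairing_wedge_diff)
  show ?thesis
    using ideal_diff[OF assms(1) _ *, of "pairing \<delta> (wedge \<omega> \<xi>)"]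
      ideal_add[OF assms(1) _ *, of "pairing \<delta> (wedge \<eta> \<xi>)"] by auto
qed

lemma mem_Der_log_iff:
  fixes \<delta> :: "'n::{finite,linorder} form"
  shows "\<delta> \<in> Der_log Z k q \<longleftrightarrow> \<delta> \<in> Theta q \<and>
     (\<forall>fs \<xi>. length fs = k \<longrightarrow> set fs \<subseteq> germ_ideal Z \<longrightarrow> \<xi> \<in> Omega (int q - int k) \<longrightarrow>
        pairing \<delta> (wedge (wedge_differentials fs) \<xi>) \<in> germ_ideal Z)"
proof (intro iffI conjI allI impI)
  assume \<delta>: "\<delta> \<in> Der_log Z k q"
  then show "\<delta> \<in> Theta q" by (simp add: Der_log_def)
  fix fs and \<xi> :: "'n form"
  assume *: "length fs = k" "set fs \<subseteq> germ_ideal Z" "\<xi> \<in> Omega (int q - int k)"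
  have "wedge (wedge_differentials fs) \<xi> \<in> log_test_forms Z k q"
    unfolding log_test_forms_def mem_Collect_eq
    by (rule exI[of _ "1::nat"], rule exI[of _ "\<lambda>_. fs"], rule exI[of _ "\<lambda>_. \<xi>"],
        use * in simp)
  then show "pairing \<delta> (wedge (wedge_differentials fs) \<xi>) \<in> germ_ideal Z"
    using \<delta> by (simp add: Der_log_def)
next
  assume *: "\<delta> \<in> Theta q \<and> (\<forall>fs \<xi>. length fs = k \<longrightarrow> set fs \<subseteq> germ_ideal Z \<longrightarrow>
     \<xi> \<in> Omega (int q - int k) \<longrightarrow>
       pairing \<delta> (wedge (wedge_differentials fs) \<xi>) \<in> germ_ideal Z)"
  have "pairing \<delta> (\<lambda>J. \<Sum>l<m. \<omega> l J) = (\<Sum>l<m. pairing \<delta> (\<omega> l))" for m :: nat and \<omega>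
    unfolding pairing_def sum_distrib_left by (rule sum.swap)
  then show "\<delta> \<in> Der_log Z k q"
    using * by (auto simp: Der_log_def log_test_forms_def intro!: ideal_sum[OF ideal_germ_ideal])
qed

lemma nonzerodivisor_power_cancel:
  assumes "\<And>f. f * a \<in> I \<Longrightarrow> f \<in> I" "a ^ m * f \<in> I"
  shows "f \<in> (I :: 'a::comm_ring_1 set)"
  using assms(2)
proof (induction m)
  case (Suc m)
  then show ?case using assms(1)[of "a ^ m * f"] by (simp add: mult_ac)
qed simp

theorem lemma3p20:
  fixes V C :: "(complex ^ 'n::{finite,linorder}) set"
    and hs :: "'n conv_series list"
    and \<alpha> :: "'n form"
    and k q :: nat
  assumes "k \<ge> 2"
    and "analytic_germ V" and "germ_codim V k" and "cohen_macaulay_local (structure_ring V)"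
    and "complete_intersection C hs" and "length hs = k" and "germ_codim C k"
    and "germ_subset V C"
    and "fundamental_form C hs V \<alpha>"
  shows "Der_log C k q \<subseteq>
           {\<delta> \<in> Theta q. \<forall>\<xi>\<in>Omega (int q - int k). pairing \<delta> (wedge \<alpha> \<xi>) \<in> germ_ideal V}
       \<and> {\<delta> \<in> Theta q. \<forall>\<xi>\<in>Omega (int q - int k). pairing \<delta> (wedge \<alpha> \<xi>) \<in> germ_ideal V} =
           Der_log V k q
       \<and> Der_log V k q =
           {\<delta> \<in> Theta q. \<forall>\<xi>\<in>Omega (int q - int k). pairing \<delta> (wedge \<alpha> \<xi>) \<in> germ_ideal C}"
proof -
  let ?h = "wedge_differentials hs"
  note idl = ideal_germ_ideal
  note CV = germ_ideal_antimono[OF assms(8)]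
  obtain a where a_cancel: "\<And>f. f * a \<in> germ_ideal V \<Longrightarrow> f \<in> germ_ideal V"
    and a_mult: "\<And>f. f \<in> germ_ideal V \<Longrightarrow> a * f \<in> germ_ideal C"
    and \<alpha>_h: "\<And>J. \<alpha> J - ?h J \<in> germ_ideal V"
    and \<alpha>_mult: "\<And>J f. f \<in> germ_ideal V \<Longrightarrow> \<alpha> J * f \<in> germ_ideal C"
    by (rule fundamental_form_congruences[OF assms(9,8)]) (rule that)
  have IC: "germ_ideal C = Idl\<^bsub>O_Y\<^esub> (set hs)"
    using assms(5) by (simp add: complete_intersection_def)
  interpret O: cring O_Y by (rule cring_from_type_algebra)
  have hs: "set hs \<subseteq> germ_ideal C"
    unfolding IC by (rule O.genideal_self) (simp add: ring_of_type_algebra_def)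
  have \<alpha>_iff_h: "pairing \<delta> (wedge \<alpha> \<xi>) \<in> germ_ideal V \<longleftrightarrow>
      pairing \<delta> (wedge ?h \<xi>) \<in> germ_ideal V" for \<delta> \<xi>
    by (rule pairing_wedge_cong[OF idl \<alpha>_h])
  have V_iff_C: "pairing \<delta> (wedge \<alpha> \<xi>) \<in> germ_ideal V \<longleftrightarrow>
      pairing \<delta> (wedge \<alpha> \<xi>) \<in> germ_ideal C" for \<delta> \<xi>
  proof
    let ?p = "pairing \<delta> (wedge \<alpha> \<xi>)"
    \<comment> \<open>The square of \<open>?p\<close> is the pairing of \<open>\<delta>\<close> with \<open>?p \<alpha> \<and> \<xi>\<close>.\<close>
    assume "?p \<in> germ_ideal V"
    then have "pairing \<delta> (wedge (\<lambda>J. ?p * \<alpha> J) \<xi>) \<in> germ_ideal C"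
      using \<alpha>_mult
      by (intro pairing_wedge_congruent_zero[OF idl]) (simp add: mult.commute[of ?p])
    then show "?p \<in> germ_ideal C"
      unfolding pairing_wedge_scale by (rule germ_ideal_radical)
  qed (use CV in blast)
  have C_sub: "pairing \<delta> (wedge \<alpha> \<xi>) \<in> germ_ideal V"
    if "\<delta> \<in> Der_log C k q" "\<xi> \<in> Omega (int q - int k)" for \<delta> \<xi>
  proof -
    have "pairing \<delta> (wedge ?h \<xi>) \<in> germ_ideal C"
      using that hs assms(6) by (simp add: mem_Der_log_iff)
    then show ?thesis
      using \<alpha>_iff_h subsetD[OF CV] by simp
  qed
  have V_sub: "pairing \<delta> (wedge \<alpha> \<xi>) \<in> germ_ideal V"
    if "\<delta> \<in> Der_log V k q" "\<xi> \<in> Omega (int q - int k)" for \<delta> \<xi>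
  proof -
    have "pairing \<delta> (wedge ?h \<xi>) \<in> germ_ideal V"
      using that order_trans[OF hs CV] assms(6) by (simp add: mem_Der_log_iff)
    then show ?thesis
      using \<alpha>_iff_h by simp
  qed
  have sub_V: "pairing \<delta> (wedge (wedge_differentials fs) \<xi>) \<in> germ_ideal V"
    if "pairing \<delta> (wedge \<alpha> \<xi>) \<in> germ_ideal V"
      "length fs = k" "set fs \<subseteq> germ_ideal V" for \<delta> \<xi> fs
  proof -
    have "set hs \<subseteq> germ_ideal V" "length fs = length hs"
      using hs CV that(2) assms(6) by auto
    then obtain c where c: "\<And>J. a ^ k * wedge_differentials fs J - c * ?h J \<in> germ_ideal V"
      using wedge_differentials_proportional[OF idl _ a_mult[unfolded IC] \<open>set fs \<subseteq> germ_ideal V\<close>]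
        \<open>length fs = k\<close> by blast
    have "c * pairing \<delta> (wedge ?h \<xi>) \<in> germ_ideal V"
      using that(1) unfolding \<alpha>_iff_h by (rule ideal_mult_left[OF idl])
    then have "a ^ k * pairing \<delta> (wedge (wedge_differentials fs) \<xi>) \<in> germ_ideal V"
      using pairing_wedge_cong[OF idl c] by (simp add: pairing_wedge_scale)
    then show ?thesis
      by (rule nonzerodivisor_power_cancel[rotated]) (fact a_cancel)
  qed
  show ?thesis
  proof (intro conjI)
    show "Der_log C k q \<subseteq>
        {\<delta> \<in> Theta q. \<forall>\<xi>\<in>Omega (int q - int k). pairing \<delta> (wedge \<alpha> \<xi>) \<in> germ_ideal V}"
      using C_sub by (auto simp: Der_log_def)
    show eq: "{\<delta> \<in> Theta q. \<forall>\<xi>\<in>Omega (int q - int k). pairing \<delta> (wedge \<alpha> \<xi>) \<in> germ_ideal V} =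
        Der_log V k q"
    proof (intro equalityI subsetI)
      fix \<delta> assume "\<delta> \<in> {\<delta> \<in> Theta q.
        \<forall>\<xi>\<in>Omega (int q - int k). pairing \<delta> (wedge \<alpha> \<xi>) \<in> germ_ideal V}"
      then show "\<delta> \<in> Der_log V k q"
        using sub_V by (simp add: mem_Der_log_iff)
    qed (use V_sub in \<open>auto simp: Der_log_def\<close>)
    show "Der_log V k q =
        {\<delta> \<in> Theta q. \<forall>\<xi>\<in>Omega (int q - int k). pairing \<delta> (wedge \<alpha> \<xi>) \<in> germ_ideal C}"
      unfolding eq[symmetric] by (simp only: V_iff_C)
  qed
qed

end
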